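(* Let $d\ge1$, let $W\subseteq\mathbb{R}^d$ be convex and compact, and for $t>0$ let $\eta_t$ be a Poisson point process on $W$ with intensity measure $t$ times Lebesgue measure restricted to $W$. Let $(\delta_t)_{t>0}$ be positive with $\delta_t\to0$ and $t\delta_t^d\to\infty$ as $t\to\infty$. For $\tau\in\mathbb{R}$ let $$L_t^{(\tau)}=\frac12\sum_{(x_1,x_2)\in\eta_{t,\neq}^2}\mathbf 1(\|x_1-x_2\|\le\delta_t)\|x_1-x_2\|^\tau,\qquad \tilde L_t^{(\tau)}=\frac{L_t^{(\tau)}-\mathbb{E}L_t^{(\tau)}}{\max\{t\delta_t^{\tau+d/2},\,t^{3/2}\delta_t^{\tau+d}\}},$$ where $\eta_{t,\neq}^2$ is the set of ordered pairs of distinct points of $\eta_t$. Let $\tau_1,\tau_2>-d/2$ and $a_i=\tau_i+d$. Then $$a_1\tilde L_t^{(\tau_1)}-a_2\tilde L_t^{(\tau_2)}\xrightarrow{\ \mathbb{P}\ }0\quad\text{as } t\to\infty.$$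
   Context: $L_t^{(\tau)}$ is the length power functional of the random geometric graph on the vertex set $\eta_t$ in which two distinct points are joined iff their Euclidean distance is at most $\delta_t$; the regime $t\delta_t^d\to\infty$ is the supercritical (dense) regime. Convergence is in probability. *)

theory Defs
  imports "HOL-Probability.Probability"
begin

definition poisson_pp ::
  "'w measure \<Rightarrow> ('w \<Rightarrow> 'a::euclidean_space set) \<Rightarrow> 'a set \<Rightarrow> real \<Rightarrow> bool" where
  "poisson_pp M N W c \<longleftrightarrow>
     prob_space M \<and>
     (\<forall>\<omega>\<in>space M. finite (N \<omega>) \<and> N \<omega> \<subseteq> W) \<and>
     (\<forall>A\<in>sets lborel.
        (\<lambda>\<omega>. card (N \<omega> \<inter> A)) \<in> measurable M (count_space UNIV) \<and>
        (\<forall>k::nat. measure M {\<omega>\<in>space M. card (N \<omega> \<inter> A) = k} =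
            (c * measure lborel (A \<inter> W)) ^ k / fact k * exp (- (c * measure lborel (A \<inter> W))))) \<and>
     (\<forall>(I::nat set) A. finite I \<longrightarrow> (\<forall>i\<in>I. A i \<in> sets lborel) \<longrightarrow> disjoint_family_on A I \<longrightarrow>
        prob_space.indep_vars M (\<lambda>_. count_space UNIV) (\<lambda>i \<omega>. card (N \<omega> \<inter> A i)) I)"

definition length_power :: "real \<Rightarrow> real \<Rightarrow> 'a::euclidean_space set \<Rightarrow> real" where
  "length_power tau r X =
     1/2 * (\<Sum>p\<in>{(x1, x2). x1 \<in> X \<and> x2 \<in> X \<and> x1 \<noteq> x2}.
              (if norm (fst p - snd p) \<le> r then norm (fst p - snd p) powr tau else 0))"

definition normalized_length_power ::
  "'w measure \<Rightarrow> ('w \<Rightarrow> 'a::euclidean_space set) \<Rightarrow> real \<Rightarrow> real \<Rightarrow> real \<Rightarrow> 'w \<Rightarrow> real" where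
  "normalized_length_power M N t r tau \<omega> =
     (length_power tau r (N \<omega>) - (\<integral>\<omega>'. length_power tau r (N \<omega>') \<partial>M)) /
     max (t * r powr (tau + real DIM('a) / 2)) (t powr (3/2) * r powr (tau + real DIM('a)))"

end

theory Submission
  imports Defs
begin

text \<open>
  Put \<open>a\<^sub>i = \<tau>\<^sub>i + d\<close>. Once \<open>t \<delta>\<^sub>t\<^sup>d \<ge> 1\<close>, the random variable in question is a centred sum of
  \<open>f(x - y)\<close> over the ordered pairs of distinct points, divided by \<open>t powr (3/2)\<close>. Here \<open>f\<close> is half the
  difference of the kernels \<open>a\<^sub>i (\<delta>\<^sub>t powr (- a\<^sub>i)) |z| powr \<tau>\<^sub>i\<close> on the ball of radius \<open>\<delta>\<^sub>t\<close>. By the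
  factorial moment formulas of orders 2, 3 and 4, the variance of the sum is
  \<open>4 t\<^sup>3 \<integral> (\<integral> f(x - y) dy)\<^sup>2 dx + 2 t\<^sup>2 \<integral>\<integral> f(x - y)\<^sup>2 dy dx\<close>, all integrals being over \<open>W\<close>. Both kernels
  have the integral \<open>d \<kappa>\<^sub>d\<close> over the ball, with \<open>\<kappa>\<^sub>d\<close> the volume of the unit ball, so the inner integral
  vanishes unless \<open>x\<close> lies within \<open>\<delta>\<^sub>t\<close> of the boundary of \<open>W\<close>, a layer whose volume tends to 0. The
  second term is of order \<open>t\<^sup>2 / \<delta>\<^sub>t\<^sup>d = o(t\<^sup>3)\<close>. Chebyshev's inequality concludes.
\<close>

section \<open>Tuples of distinct points\<close>

text \<open>\<open>poisson_pp\<close> prescribes only the counts of points in Borel sets: their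
  measurability, Poisson laws and independence over disjoint sets. Measurability of sums over the
  points is not given, so the moment formulas are built from counts of disjoint sets. Tuples with a
  repeated entry are the obstacle, since a point counted twice destroys independence. Removing them
  leaves a space generated by rectangles with disjoint sides, and powers of a diffuse measure give
  the removed part mass 0. Tuples are functions on \<open>{..<k}\<close>, \<open>undefined\<close>
  elsewhere, so that they are points of the product space \<open>PiM {..<k}\<close> and one
  integrand serves both sides of the moment formula.

  The weight \<open>a_i\<close> makes the limit degenerate because it cancels the denominator of the
  integral of \<open>s powr (\<tau> + d - 1)\<close> over \<open>[0, r]\<close>. The bound
  \<open>\<tau> > -d/2\<close> says that the squared kernel, with exponent \<open>2 \<tau>\<close>,
  is still integrable at the origin. Convexity makes the frontier of \<open>W\<close> a null
  set.\<close>

definition distinct_tuples :: "nat \<Rightarrow> 'a set \<Rightarrow> (nat \<Rightarrow> 'a) set" where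
  "distinct_tuples k X = {x \<in> {..<k} \<rightarrow>\<^sub>E X. inj_on x {..<k}}"

lemma finite_distinct_tuples: "finite X \<Longrightarrow> finite (distinct_tuples k X)"
  unfolding distinct_tuples_def by (rule finite_subset[OF Collect_restrict]) (auto intro: finite_PiE)

lemma distinct_tuples_0: "distinct_tuples 0 X = {\<lambda>_. undefined}"
  by (auto simp: distinct_tuples_def)

text \<open>The new entry is appended at index \<open>k\<close>, the coordinate that Fubini peels
  off first in \<open>integral_PiM_Suc\<close>.\<close>

lemma distinct_tuples_Suc:
  "distinct_tuples (Suc k) X =
     (\<lambda>(x, a). x(k := a)) ` (SIGMA x:distinct_tuples k X. X - x ` {..<k})"
  (is "_ = ?h ` ?S")
proof (intro equalityI subsetI)
  fix y assume y: "y \<in> distinct_tuples (Suc k) X"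
  define x where "x = y(k := undefined)"
  have ys: "y \<in> {..<Suc k} \<rightarrow>\<^sub>E X" and inj: "inj_on y {..<Suc k}"
    using y by (auto simp: distinct_tuples_def)
  have xy: "\<And>i. i < k \<Longrightarrow> x i = y i" by (simp add: x_def)
  have img: "x ` {..<k} = y ` {..<k}" using xy by auto
  have "x \<in> {..<k} \<rightarrow>\<^sub>E X"
    using ys by (auto simp: x_def PiE_iff extensional_def)
  moreover have "inj_on x {..<k}"
    using inj xy by (auto simp: inj_on_def)
  moreover have "y k \<in> X - x ` {..<k}"
    using ys inj_onD[OF inj, of k] unfolding img by (fastforce simp: PiE_iff)
  ultimately have "(x, y k) \<in> ?S" by (auto simp: distinct_tuples_def)
  moreover have "?h (x, y k) = y" by (simp add: x_def)
  ultimately show "y \<in> ?h ` ?S" by (metis image_eqI)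
next
  fix y assume "y \<in> ?h ` ?S"
  then obtain x a where x: "x \<in> distinct_tuples k X" and a: "a \<in> X" "a \<notin> x ` {..<k}"
    and y: "y = x(k := a)" by auto
  have "y \<in> {..<Suc k} \<rightarrow>\<^sub>E X"
    using x a by (auto simp: y distinct_tuples_def PiE_iff extensional_def less_Suc_eq)
  moreover have "inj_on y {..<Suc k}"
    using x a by (auto simp: y distinct_tuples_def inj_on_def less_Suc_eq)
  ultimately show "y \<in> distinct_tuples (Suc k) X" by (simp add: distinct_tuples_def)
qed

lemma sum_distinct_tuples_Suc:
  fixes F :: "(nat \<Rightarrow> 'a) \<Rightarrow> 'b::comm_monoid_add"
  assumes "finite X"
  shows "sum F (distinct_tuples (Suc k) X) =
    (\<Sum>x\<in>distinct_tuples k X. \<Sum>a\<in>X - x ` {..<k}. F (x(k := a)))"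
proof -
  let ?S = "SIGMA x:distinct_tuples k X. X - x ` {..<k}"
  have inj: "inj_on (\<lambda>(x, a). x(k := a)) ?S"
  proof (rule inj_onI, clarify)
    fix x a y b assume x: "x \<in> distinct_tuples k X" and y: "y \<in> distinct_tuples k X"
      and eq: "x(k := a) = y(k := b)"
    have "x k = undefined" "y k = undefined"
      using x y by (auto simp: distinct_tuples_def PiE_iff extensional_def)
    then have "x = y" using eq by (metis fun_upd_triv fun_upd_upd)
    moreover have "a = b" using eq by (metis fun_upd_same)
    ultimately show "x = y \<and> a = b" by simp
  qed
  show ?thesis
    unfolding distinct_tuples_Suc sum.reindex[OF inj]
    using assms by (subst sum.Sigma) (auto simp: finite_distinct_tuples case_prod_unfold)
qed

text \<open>The falling factorial. Truncated subtraction on \<open>nat\<close> gives a factor 0 as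
  soon as \<open>k\<close> exceeds \<open>card X\<close>, when there are no such tuples.\<close>

lemma card_distinct_tuples:
  assumes "finite X"
  shows "card (distinct_tuples k X) = (\<Prod>i<k. card X - i)"
proof (induction k)
  case 0
  then show ?case by (simp add: distinct_tuples_0)
next
  case (Suc k)
  have *: "card (X - x ` {..<k}) = card X - k" if "x \<in> distinct_tuples k X" for x
    using that by (subst card_Diff_subset) (auto simp: distinct_tuples_def PiE_iff card_image)
  have "card (distinct_tuples (Suc k) X) = (\<Sum>x\<in>distinct_tuples k X. card (X - x ` {..<k}))"
    using sum_distinct_tuples_Suc[OF assms, of "\<lambda>_. 1::nat" k] by simp
  also have "\<dots> = card (distinct_tuples k X) * (card X - k)"
    using * by simp
  finally show ?case using Suc by simp
qed

text \<open>Disjoint sides force distinct entries, so the injectivity condition disappears and the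
  tuples in the rectangle are counted by a product of counts.\<close>

lemma distinct_tuples_Int_PiE:
  assumes "disjoint_family_on A {..<k}"
  shows "distinct_tuples k X \<inter> PiE {..<k} A = PiE {..<k} (\<lambda>i. X \<inter> A i)"
proof -
  have "inj_on x {..<k}" if "x \<in> PiE {..<k} (\<lambda>i. X \<inter> A i)" for x
  proof (rule inj_onI, rule ccontr)
    fix i j assume ij: "i \<in> {..<k}" "j \<in> {..<k}" "x i = x j" "i \<noteq> j"
    have "x i \<in> A i" "x j \<in> A j" using that ij(1,2) by (auto simp: PiE_iff)
    then have "x i \<in> A i \<inter> A j" using ij(3) by simp
    then show False using assms ij by (auto simp: disjoint_family_on_def)
  qed
  then show ?thesis by (auto simp: distinct_tuples_def PiE_iff)
qed

lemma sum_distinct_tuples_2: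
  assumes "finite X"
  shows "(\<Sum>x\<in>distinct_tuples 2 X. F (x 0) (x 1)) = (\<Sum>a\<in>X. \<Sum>b\<in>X - {a}. F a b)"
  using assms by (simp add: numeral_2_eq_2 sum_distinct_tuples_Suc distinct_tuples_0 lessThan_Suc)

lemma sum_distinct_tuples_3:
  assumes "finite X"
  shows "(\<Sum>x\<in>distinct_tuples 3 X. F (x 0) (x 1) (x 2)) =
    (\<Sum>a\<in>X. \<Sum>b\<in>X - {a}. \<Sum>c\<in>X - {a, b}. F a b c)"
  using assms by (simp add: numeral_3_eq_3 numeral_2_eq_2 sum_distinct_tuples_Suc distinct_tuples_0
      lessThan_Suc insert_commute)

lemma sum_distinct_tuples_4:
  assumes "finite X"
  shows "(\<Sum>x\<in>distinct_tuples 4 X. F (x 0) (x 1) (x 2) (x 3)) =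
    (\<Sum>a\<in>X. \<Sum>b\<in>X - {a}. \<Sum>c\<in>X - {a, b}. \<Sum>d\<in>X - {a, b, c}. F a b c d)"
proof -
  have 4: "(4::nat) = Suc (Suc (Suc (Suc 0)))" by simp
  have i: "X - {c, b, a} = X - {a, b, c}" for a b c by auto
  show ?thesis
    using assms by (simp add: 4 numeral_3_eq_3 numeral_2_eq_2 sum_distinct_tuples_Suc distinct_tuples_0
      lessThan_Suc insert_commute i)
qed

text \<open>A product over two pairs of points is sorted by the number of points that the pairs share.\<close>

lemma pair_sum_squared:
  fixes f :: "'a \<Rightarrow> 'a \<Rightarrow> real"
  assumes X: "finite X" and sym: "\<And>x y. f x y = f y x" and diag: "\<And>x. f x x = 0"
  shows "(\<Sum>x\<in>distinct_tuples 2 X. f (x 0) (x 1))\<^sup>2 =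
    (\<Sum>x\<in>distinct_tuples 4 X. f (x 0) (x 1) * f (x 2) (x 3)) +
    4 * (\<Sum>x\<in>distinct_tuples 3 X. f (x 0) (x 1) * f (x 0) (x 2)) +
    2 * (\<Sum>x\<in>distinct_tuples 2 X. (f (x 0) (x 1))\<^sup>2)"
proof -
  define S where "S = (\<Sum>a\<in>X. \<Sum>b\<in>X. f a b)"
  \<comment> \<open>As \<open>f a a = 0\<close>, the index \<open>a\<close> may be added or dropped
    at will.\<close>
  have del: "(\<Sum>b\<in>X - {a}. f a b * h b) = (\<Sum>b\<in>X. f a b * h b)" for a h
    using X by (cases "a \<in> X") (simp_all add: sum.remove diag)
  have S2: "(\<Sum>x\<in>distinct_tuples 2 X. f (x 0) (x 1)) = S"
    using del[of _ "\<lambda>_. 1"] sum_distinct_tuples_2[OF X, of f] by (simp add: S_def)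
  \<comment> \<open>For a fixed pair \<open>a\<close>, \<open>b\<close>, the pairs
    \<open>(c, d)\<close> are sorted by which of their entries lie in \<open>{a, b}\<close>.
    Symmetry produces the factors 2, the last one from \<open>(a, b)\<close> and
    \<open>(b, a)\<close>.\<close>
  have split: "S = (\<Sum>c\<in>X - {a, b}. \<Sum>d\<in>X - {a, b, c}. f c d) + 2 * (\<Sum>d\<in>X - {a, b}. f a d)
      + 2 * (\<Sum>d\<in>X - {a, b}. f b d) + 2 * f a b"
    if ab: "a \<in> X" "b \<in> X" "a \<noteq> b" for a b
  proof -
    let ?Y = "X - {a, b}"
    have spl: "sum h X = h a + h b + sum h ?Y" for h :: "'a \<Rightarrow> real"
    proof -
      have "sum h X = h a + (h b + sum h (X - {a} - {b}))"
        using X ab by (simp add: sum.remove)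
      moreover have "X - {a} - {b} = ?Y" by auto
      ultimately show ?thesis by simp
    qed
    have inner: "(\<Sum>d\<in>X - {a, b, c}. f c d) = (\<Sum>d\<in>?Y. f c d)" if "c \<in> ?Y" for c
    proof -
      have "X - {a, b, c} = ?Y - {c}" by auto
      then show ?thesis using X that by (simp add: sum.remove[of ?Y c] diag)
    qed
    have "S = (\<Sum>c\<in>?Y. \<Sum>d\<in>?Y. f c d) + 2 * (\<Sum>d\<in>?Y. f a d) + 2 * (\<Sum>d\<in>?Y. f b d) + 2 * f a b"
      unfolding S_def spl
      by (simp add: sum.distrib diag sym[of _ a] sym[of b])
    then show ?thesis using inner by simp
  qed
  let ?T3 = "\<Sum>a\<in>X. \<Sum>b\<in>X - {a}. \<Sum>c\<in>X - {a, b}. f a b * f a c"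
  \<comment> \<open>Exchanging \<open>a\<close> and \<open>b\<close> turns a shared second point
    into a shared first point; the two kinds of triples add up to the coefficient 4.\<close>
  have swap: "(\<Sum>a\<in>X. \<Sum>b\<in>X - {a}. \<Sum>c\<in>X - {a, b}. f a b * f b c) = ?T3"
  proof -
    have "(\<Sum>a\<in>X. \<Sum>b\<in>X - {a}. \<Sum>c\<in>X - {a, b}. f a b * f b c) =
        (\<Sum>a\<in>X. \<Sum>b\<in>X. f a b * (\<Sum>c\<in>X - {a, b}. f b c))"
      by (simp add: sum_distrib_left[symmetric] del)
    also have "\<dots> = (\<Sum>b\<in>X. \<Sum>a\<in>X. f b a * (\<Sum>c\<in>X - {b, a}. f b c))"
      by (subst sum.swap) (simp add: sym insert_commute)
    also have "\<dots> = ?T3"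
      by (simp add: sum_distrib_left[symmetric] del)
    finally show ?thesis .
  qed
  have "S\<^sup>2 = (\<Sum>a\<in>X. \<Sum>b\<in>X - {a}. f a b * S)"
    by (simp add: del S_def sum_distrib_right power2_eq_square)
  also have "\<dots> = (\<Sum>a\<in>X. \<Sum>b\<in>X - {a}. f a b * ((\<Sum>c\<in>X - {a, b}. \<Sum>d\<in>X - {a, b, c}. f c d)
      + 2 * (\<Sum>d\<in>X - {a, b}. f a d) + 2 * (\<Sum>d\<in>X - {a, b}. f b d) + 2 * f a b))"
    by (intro sum.cong refl arg_cong2[where f = "(*)"] split) auto
  also have "\<dots> = (\<Sum>a\<in>X. \<Sum>b\<in>X - {a}. \<Sum>c\<in>X - {a, b}. \<Sum>d\<in>X - {a, b, c}. f a b * f c d) +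
      2 * ?T3 + 2 * (\<Sum>a\<in>X. \<Sum>b\<in>X - {a}. \<Sum>c\<in>X - {a, b}. f a b * f b c) +
      2 * (\<Sum>a\<in>X. \<Sum>b\<in>X - {a}. (f a b)\<^sup>2)"
    by (simp add: distrib_left sum.distrib sum_distrib_left power2_eq_square mult_ac)
  finally show ?thesis
    unfolding S2 swap using sum_distinct_tuples_4[OF X, of "\<lambda>a b c d. f a b * f c d"]
      sum_distinct_tuples_3[OF X, of "\<lambda>a b c. f a b * f a c"]
      sum_distinct_tuples_2[OF X, of "\<lambda>a b. (f a b)\<^sup>2"] by simp
qed

section \<open>Factorial moments of the Poisson law\<close>

lemma sums_falling_factorial_poisson:
  fixes l :: real
  shows "(\<lambda>n. real (\<Prod>i<k. n - i) * (l ^ n / fact n * exp (- l))) sums (l ^ k)"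
proof -
  \<comment> \<open>Shifted by \<open>k\<close>, the falling factorial is a quotient of factorials
    and cancels against the Poisson weights, leaving \<open>l ^ k\<close> times the exponential
    series.\<close>
  have fall: "real (\<Prod>i<k. n + k - i) = fact (n + k) / fact n" for n
  proof (induction k)
    case (Suc k)
    have "(\<Prod>i<Suc k. n + Suc k - i) = (n + Suc k) * (\<Prod>i<k. n + k - i)"
      by (subst prod.lessThan_Suc_shift) simp
    then have "real (\<Prod>i<Suc k. n + Suc k - i) = real (n + Suc k) * real (\<Prod>i<k. n + k - i)"
      by (simp only: of_nat_mult)
    then show ?case unfolding Suc by simp
  qed simp
  have zero: "(\<Prod>i<k. n - i) = 0" if "n < k" for n
    using that by (intro prod_zero) auto
  have "(\<lambda>n. l ^ k * exp (- l) * (l ^ n / fact n)) sums (l ^ k * exp (- l) * exp l)"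
    by (intro sums_mult) (use exp_converges[of l] in \<open>simp add: divide_inverse mult.commute\<close>)
  also have "l ^ k * exp (- l) * exp l = l ^ k"
    by (simp add: exp_minus)
  also have "(\<lambda>n. l ^ k * exp (- l) * (l ^ n / fact n)) =
    (\<lambda>n. real (\<Prod>i<k. n + k - i) * (l ^ (n + k) / fact (n + k) * exp (- l)))"
    unfolding fall by (simp add: field_simps power_add)
  finally show ?thesis
    by (subst (asm) sums_zero_iff_shift) (auto simp: zero)
qed

text \<open>For \<open>k = 1\<close> this is the mean of a count; general \<open>k\<close> gives the
  expected number of all \<open>k\<close>-tuples of distinct points, a falling factorial of one
  Poisson count.\<close>

lemma (in prob_space) nn_integral_falling_factorial_poisson:
  assumes X: "X \<in> measurable M (count_space (UNIV :: nat set))"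
    and p: "\<And>n. prob {\<omega> \<in> space M. X \<omega> = n} = l ^ n / fact n * exp (- l)"
    and l: "0 \<le> l"
  shows "(\<integral>\<^sup>+\<omega>. ennreal (real (\<Prod>i<k. X \<omega> - i)) \<partial>M) = ennreal (l ^ k)"
proof -
  have "(\<integral>\<^sup>+\<omega>. ennreal (real (\<Prod>i<k. X \<omega> - i)) \<partial>M) =
      (\<integral>\<^sup>+n. ennreal (real (\<Prod>i<k. n - i)) \<partial>distr M (count_space UNIV) X)"
    using X by (subst nn_integral_distr) auto
  also have "distr M (count_space UNIV) X = density (count_space UNIV) (\<lambda>n. ennreal (l ^ n / fact n * exp (- l)))"
  proof (rule measure_eqI_countable[of _ UNIV])
    fix n
    show "emeasure (distr M (count_space UNIV) X) {n} =
        emeasure (density (count_space UNIV) (\<lambda>n. ennreal (l ^ n / fact n * exp (- l)))) {n}"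
      using X p[of n]
      by (auto simp: emeasure_distr emeasure_density emeasure_eq_measure vimage_def Int_def conj_commute
          nn_integral_count_space_indicator[symmetric] nn_integral_count_space_finite)
  qed auto
  also have "(\<integral>\<^sup>+n. ennreal (real (\<Prod>i<k. n - i)) \<partial>density (count_space UNIV) (\<lambda>n. ennreal (l ^ n / fact n * exp (- l))))
      = (\<Sum>n. ennreal (real (\<Prod>i<k. n - i) * (l ^ n / fact n * exp (- l))))"
    using l by (subst nn_integral_density)
      (auto simp: nn_integral_count_space_nat ennreal_mult[symmetric] mult.commute
         simp del: of_nat_prod intro!: suminf_cong)
  also have "\<dots> = ennreal (l ^ k)"
    by (intro suminf_ennreal_eq sums_falling_factorial_poisson) (simp add: l prod_nonneg)
  finally show ?thesis .
qed

section \<open>Open boxes that separate distinct points\<close>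

lemma countable_disjoint_neighbourhoods:
  fixes k :: nat
  obtains \<B> :: "(nat \<Rightarrow> 'a::{second_countable_topology, metric_space} set) set"
  where "countable \<B>"
    and "\<And>b. b \<in> \<B> \<Longrightarrow> disjoint_family_on b {..<k} \<and> (\<forall>i. open (b i))"
    and "\<And>x. inj_on x {..<k} \<Longrightarrow> \<exists>b\<in>\<B>. \<forall>i<k. x i \<in> b i"
proof -
  obtain D :: "'a set set" where D: "countable D" "topological_basis D"
    using ex_countable_basis by blast
  define ext where "ext b = (\<lambda>i. if i < k then b i else ({} :: 'a set))" for b
  define \<B> where "\<B> = {b \<in> ext ` ({..<k} \<rightarrow>\<^sub>E D). disjoint_family_on b {..<k}}"
  \<comment> \<open>Countability comes from the countable basis. It is what later allows an
    off-diagonal set to be written as a union inside a generated \<sigma>-algebra.\<close>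
  have "countable \<B>"
    unfolding \<B>_def using D by (intro countable_subset[OF Collect_restrict] countable_image countable_PiE) auto
  moreover have "disjoint_family_on b {..<k} \<and> (\<forall>i. open (b i))" if "b \<in> \<B>" for b
    using that topological_basis_open[OF D(2)] by (auto simp: \<B>_def ext_def PiE_iff)
  moreover have "\<exists>b\<in>\<B>. \<forall>i<k. x i \<in> b i" if inj: "inj_on x {..<k}" for x
  proof -
    have "finite (x ` {..<k})" by simp
    then obtain e where e: "e > 0" "\<And>u v. u \<in> x ` {..<k} \<Longrightarrow> v \<in> x ` {..<k} \<Longrightarrow> u \<noteq> v \<Longrightarrow> e \<le> dist u v"
    proof -
      \<comment> \<open>The extra element 1 keeps the minimum defined when there are no two
        different entries.\<close>
      define E where "E = insert 1 ((\<lambda>(u, v). dist u v) ` {(u, v). u \<in> x ` {..<k} \<and> v \<in> x ` {..<k} \<and> u \<noteq> v})"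
      have "finite {(u, v). u \<in> x ` {..<k} \<and> v \<in> x ` {..<k} \<and> u \<noteq> v}"
        by (rule finite_subset[of _ "x ` {..<k} \<times> x ` {..<k}"]) auto
      then have fin: "finite E" by (simp add: E_def)
      have "Min E > 0" using fin by (subst Min_gr_iff) (auto simp: E_def)
      moreover have "Min E \<le> dist u v" if "u \<in> x ` {..<k}" "v \<in> x ` {..<k}" "u \<noteq> v" for u v
        using fin that by (intro Min_le) (auto simp: E_def)
      ultimately show ?thesis using that by blast
    qed
    have "\<exists>B. B \<in> D \<and> x i \<in> B \<and> B \<subseteq> ball (x i) (e / 2)" for i
      using topological_basisE[OF D(2), of "ball (x i) (e / 2)" "x i"] e(1) by auto
    then obtain b where b: "\<And>i. b i \<in> D \<and> x i \<in> b i \<and> b i \<subseteq> ball (x i) (e / 2)" by metis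
    have disj: "disjoint_family_on b {..<k}"
      unfolding disjoint_family_on_def
    proof (intro ballI impI, rule ccontr)
      fix i j assume ij: "i \<in> {..<k}" "j \<in> {..<k}" "i \<noteq> j" and "b i \<inter> b j \<noteq> {}"
      then obtain z where "z \<in> b i" "z \<in> b j" by blast
      then have "dist (x i) z < e / 2" "dist (x j) z < e / 2" using b by (auto simp: subset_eq)
      then have "dist (x i) (x j) < e" by (metis dist_triangle_half_l dist_commute)
      moreover have "x i \<noteq> x j" using inj ij by (auto dest: inj_onD)
      ultimately show False using e(2)[of "x i" "x j"] ij by auto
    qed
    have "ext (restrict b {..<k}) \<in> \<B>"
      unfolding \<B>_def using b disj
      by (auto intro!: imageI simp: ext_def disjoint_family_on_def)
    then show ?thesis using b by (intro bexI[of _ "ext (restrict b {..<k})"]) (auto simp: ext_def)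
  qed
  ultimately show thesis using that by blast
qed

text \<open>Off the diagonals, rectangles with pairwise disjoint sides generate the product
  \<open>\<sigma>\<close>-algebra. On such rectangles the factorial moment is the expectation of a product of
  independent counts.\<close>

lemma off_diagonal_in_sigma_sets:
  fixes B :: "(nat \<Rightarrow> 'a::{second_countable_topology, metric_space}) set"
  assumes "B \<in> sets (PiM {..<k} (\<lambda>_. borel))"
  defines "\<Omega> \<equiv> {x \<in> {..<k} \<rightarrow>\<^sub>E UNIV. inj_on x {..<k}}"
  shows "B \<inter> \<Omega> \<in> sigma_sets \<Omega> {PiE {..<k} A | A. (\<forall>i<k. A i \<in> sets borel) \<and> disjoint_family_on A {..<k}}"
    (is "_ \<in> sigma_sets \<Omega> ?G")
proof -
  obtain \<B> :: "(nat \<Rightarrow> 'a set) set" where \<B>: "countable \<B>"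
    "\<And>b. b \<in> \<B> \<Longrightarrow> disjoint_family_on b {..<k} \<and> (\<forall>i. open (b i))"
    "\<And>x. inj_on x {..<k} \<Longrightarrow> \<exists>b\<in>\<B>. \<forall>i<k. x i \<in> b i"
    using countable_disjoint_neighbourhoods[of k] by blast
  have "B \<in> sigma_sets ({..<k} \<rightarrow>\<^sub>E UNIV) {PiE {..<k} X |X. X \<in> {..<k} \<rightarrow> sets (borel :: 'a measure)}"
    using assms(1) by (simp add: sets_PiM prod_algebra_eq_finite)
  then show ?thesis
  proof (induction rule: sigma_sets.induct)
    case (Basic R)
    then obtain X where R: "R = PiE {..<k} X" and X: "\<And>i. i < k \<Longrightarrow> X i \<in> sets borel" by auto
    \<comment> \<open>Cutting by the separating boxes turns an arbitrary rectangle into countably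
      many rectangles with disjoint sides.\<close>
    have "R \<inter> \<Omega> = (\<Union>b\<in>\<B>. PiE {..<k} (\<lambda>i. X i \<inter> b i))"
    proof (intro equalityI subsetI)
      fix x assume x: "x \<in> R \<inter> \<Omega>"
      then obtain b where "b \<in> \<B>" "\<forall>i<k. x i \<in> b i" using \<B>(3)[of x] by (auto simp: \<Omega>_def)
      then show "x \<in> (\<Union>b\<in>\<B>. PiE {..<k} (\<lambda>i. X i \<inter> b i))"
        using x by (intro UN_I[of b]) (auto simp: R PiE_iff)
    next
      fix x assume "x \<in> (\<Union>b\<in>\<B>. PiE {..<k} (\<lambda>i. X i \<inter> b i))"
      then obtain b where b: "b \<in> \<B>" "x \<in> PiE {..<k} (\<lambda>i. X i \<inter> b i)" by auto
      have "x \<in> distinct_tuples k UNIV"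
      proof -
        have "x \<in> PiE {..<k} b" using b(2) by (auto simp: PiE_iff)
        then show ?thesis
          using distinct_tuples_Int_PiE[of b k UNIV] \<B>(2)[OF b(1)] by auto
      qed
      then show "x \<in> R \<inter> \<Omega>" using b(2) by (auto simp: R \<Omega>_def distinct_tuples_def PiE_iff)
    qed
    also have "\<dots> \<in> sigma_sets \<Omega> ?G"
    proof (rule sigma_sets_UNION)
      show "countable ((\<lambda>b. PiE {..<k} (\<lambda>i. X i \<inter> b i)) ` \<B>)" using \<B>(1) by simp
      fix S assume "S \<in> (\<lambda>b. PiE {..<k} (\<lambda>i. X i \<inter> b i)) ` \<B>"
      then obtain b where b: "b \<in> \<B>" "S = PiE {..<k} (\<lambda>i. X i \<inter> b i)" by auto
      have "disjoint_family_on (\<lambda>i. X i \<inter> b i) {..<k}"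
        using \<B>(2)[OF b(1)] by (auto simp: disjoint_family_on_def)
      then have "S \<in> ?G"
        unfolding b(2) using \<B>(2)[OF b(1)] X by (intro CollectI exI[of _ "\<lambda>i. X i \<inter> b i"]) auto
      then show "S \<in> sigma_sets \<Omega> ?G" by blast
    qed
    finally show ?case .
  next
    case Empty
    then show ?case by (simp add: sigma_sets.Empty)
  next
    case (Compl R)
    have "(({..<k} \<rightarrow>\<^sub>E UNIV) - R) \<inter> \<Omega> = \<Omega> - (R \<inter> \<Omega>)" by (auto simp: \<Omega>_def)
    then show ?case using sigma_sets.Compl[OF Compl.IH] by simp
  next
    case (Union R)
    have "(\<Union>i. R i) \<inter> \<Omega> = (\<Union>i. R i \<inter> \<Omega>)" by auto
    then show ?case using sigma_sets.Union[OF Union.IH] by simp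
  qed
qed

section \<open>Factorial moments of a Poisson process\<close>

text \<open>The intensity is any finite diffuse Borel measure, so the moment formulas are free of
  \<open>t\<close>, \<open>W\<close> and the Euclidean structure. The range of \<open>N\<close>
  carries no \<sigma>-algebra; measurability is assumed for counts only.\<close>

locale poisson_process = prob_space M for M :: "'w measure" +
  fixes N :: "'w \<Rightarrow> 'a::{second_countable_topology, metric_space} set"
    and \<rho> :: "'a measure"
  assumes finite_points: "\<And>\<omega>. \<omega> \<in> space M \<Longrightarrow> finite (N \<omega>)"
    and sets_intensity [measurable_cong, simp]: "sets \<rho> = sets borel"
    and finite_intensity: "finite_measure \<rho>"
    and diffuse: "\<And>x. emeasure \<rho> {x} = 0"
    and measurable_count: "\<And>A. A \<in> sets borel \<Longrightarrow>
      (\<lambda>\<omega>. card (N \<omega> \<inter> A)) \<in> measurable M (count_space UNIV)"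
    and prob_count: "\<And>A n. A \<in> sets borel \<Longrightarrow> prob {\<omega> \<in> space M. card (N \<omega> \<inter> A) = n} =
      measure \<rho> A ^ n / fact n * exp (- measure \<rho> A)"
    and indep_counts: "\<And>(I :: nat set) A. finite I \<Longrightarrow> (\<And>i. i \<in> I \<Longrightarrow> A i \<in> sets borel) \<Longrightarrow>
      disjoint_family_on A I \<Longrightarrow> indep_vars (\<lambda>_. count_space UNIV) (\<lambda>i \<omega>. card (N \<omega> \<inter> A i)) I"
begin

sublocale intensity: finite_measure \<rho> by (rule finite_intensity)

sublocale product_sigma_finite "\<lambda>_::nat. \<rho>" by standard

lemma space_intensity [simp]: "space \<rho> = UNIV"
  using sets_eq_imp_space_eq[OF sets_intensity] by simp

lemma sets_PiM_intensity [simp]: "sets (PiM I (\<lambda>_::nat. \<rho>)) = sets (PiM I (\<lambda>_. borel))"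
  by (intro sets_PiM_cong) auto

lemma nn_integral_count:
  assumes "A \<in> sets borel"
  shows "(\<integral>\<^sup>+\<omega>. ennreal (real (card (N \<omega> \<inter> A))) \<partial>M) = emeasure \<rho> A"
  using nn_integral_falling_factorial_poisson[OF measurable_count[OF assms] prob_count[OF assms], of 1]
  by (simp add: intensity.emeasure_eq_measure)

lemma measurable_diagonal [measurable]:
  fixes i j k :: nat
  shows "i < k \<Longrightarrow> j < k \<Longrightarrow> {x \<in> space (PiM {..<k} (\<lambda>_. \<rho>)). x i = x j} \<in> sets (PiM {..<k} (\<lambda>_. \<rho>))"
  by measurable

text \<open>Fubini in the coordinate \<open>i\<close>: each section is the singleton
  \<open>{x j}\<close>, a null set of a diffuse measure.\<close>

lemma null_diagonal:
  fixes i j k :: nat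
  assumes "i < k" "j < k" "i \<noteq> j"
  shows "emeasure (PiM {..<k} (\<lambda>_. \<rho>)) {x \<in> space (PiM {..<k} (\<lambda>_. \<rho>)). x i = x j} = 0"
proof -
  let ?J = "{..<k} - {i}"
  have ins: "insert i ?J = {..<k}" using assms by auto
  let ?D = "{x \<in> space (PiM {..<k} (\<lambda>_. \<rho>)). x i = x j}"
  have m: "(indicator ?D :: _ \<Rightarrow> ennreal) \<in> borel_measurable (PiM (insert i ?J) (\<lambda>_. \<rho>))"
    unfolding ins using measurable_diagonal[OF assms(1,2)] by (rule borel_measurable_indicator)
  have "emeasure (PiM {..<k} (\<lambda>_. \<rho>)) ?D = (\<integral>\<^sup>+x. indicator ?D x \<partial>PiM (insert i ?J) (\<lambda>_. \<rho>))"
    using measurable_diagonal[OF assms(1,2)] by (simp only: ins nn_integral_indicator)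
  also have "\<dots> = (\<integral>\<^sup>+x. (\<integral>\<^sup>+y. indicator ?D (x(i := y)) \<partial>\<rho>) \<partial>PiM ?J (\<lambda>_. \<rho>))"
    by (rule product_nn_integral_insert[OF _ _ m]) auto
  also have "\<dots> = (\<integral>\<^sup>+x. 0 \<partial>PiM ?J (\<lambda>_. \<rho>))"
  proof (rule nn_integral_cong)
    fix x assume "x \<in> space (PiM ?J (\<lambda>_. \<rho>))"
    then have "x(i := y) \<in> space (PiM {..<k} (\<lambda>_. \<rho>))" for y
      using assms(1) by (auto simp: space_PiM PiE_iff extensional_def)
    then have "(\<integral>\<^sup>+y. indicator ?D (x(i := y)) \<partial>\<rho>) = (\<integral>\<^sup>+y. indicator {x j} y \<partial>\<rho>)"
      using assms(3) by (intro nn_integral_cong) (auto simp: indicator_def)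
    then show "(\<integral>\<^sup>+y. indicator ?D (x(i := y)) \<partial>\<rho>) = 0"
      by (simp add: diffuse)
  qed
  finally show ?thesis by simp
qed

lemma AE_inj:
  fixes k :: nat
  shows "AE x in PiM {..<k} (\<lambda>_. \<rho>). inj_on x {..<k}"
proof -
  have "AE x in PiM {..<k} (\<lambda>_. \<rho>). \<forall>i\<in>{..<k}. \<forall>j\<in>{..<k} - {i}. x i \<noteq> x j"
  proof (intro AE_finite_allI)
    fix i j assume "i \<in> {..<k}" "j \<in> {..<k} - {i}"
    then show "AE x in PiM {..<k} (\<lambda>_. \<rho>). x i \<noteq> x j"
      using null_diagonal[of i k j] measurable_diagonal[of i k j]
      by (intro AE_I[where N = "{x \<in> space (PiM {..<k} (\<lambda>_. \<rho>)). x i = x j}"]) auto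
  qed auto
  then show ?thesis by eventually_elim (auto simp: inj_on_def)
qed

text \<open>Independence over disjoint sets turns the expected product of counts into the product of
  their means, which is the measure of the rectangle.\<close>

lemma factorial_moment_disjoint_rectangle:
  assumes A: "\<And>i. i < k \<Longrightarrow> A i \<in> sets borel" "disjoint_family_on A {..<k}"
  shows "(\<lambda>\<omega>. \<Sum>x\<in>distinct_tuples k (N \<omega>). indicator (PiE {..<k} A) x :: ennreal) \<in> borel_measurable M"
    and "(\<integral>\<^sup>+\<omega>. (\<Sum>x\<in>distinct_tuples k (N \<omega>). indicator (PiE {..<k} A) x) \<partial>M) =
      emeasure (PiM {..<k} (\<lambda>_. \<rho>)) (PiE {..<k} A)"
proof -
  have eq: "(\<Sum>x\<in>distinct_tuples k (N \<omega>). indicator (PiE {..<k} A) x) =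
      (\<Prod>i<k. ennreal (real (card (N \<omega> \<inter> A i))))" if "\<omega> \<in> space M" for \<omega>
  proof -
    have "(\<Sum>x\<in>distinct_tuples k (N \<omega>). indicator (PiE {..<k} A) x) =
        of_nat (card (distinct_tuples k (N \<omega>) \<inter> PiE {..<k} A))"
      using finite_distinct_tuples[OF finite_points[OF that], of k]
      by (simp add: indicator_def sum.If_cases)
    also have "\<dots> = (\<Prod>i<k. ennreal (real (card (N \<omega> \<inter> A i))))"
      by (simp add: distinct_tuples_Int_PiE[OF A(2)] card_PiE ennreal_of_nat_eq_real_of_nat prod_ennreal)
    finally show ?thesis .
  qed
  have m: "(\<lambda>\<omega>. ennreal (real (card (N \<omega> \<inter> A i)))) \<in> borel_measurable M" if "i < k" for i
    using measurable_compose[OF measurable_count[OF A(1)[OF that]], of "\<lambda>n. ennreal (real n)" borel]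
    by (simp del: measurable_ennreal)
  show "(\<lambda>\<omega>. \<Sum>x\<in>distinct_tuples k (N \<omega>). indicator (PiE {..<k} A) x :: ennreal) \<in> borel_measurable M"
    using m by (subst measurable_cong[OF eq]) auto
  have "indep_vars (\<lambda>_. borel) (\<lambda>i \<omega>. ennreal (real (card (N \<omega> \<inter> A i)))) {..<k}"
    using indep_vars_compose2[OF indep_counts[of "{..<k}" A], of "\<lambda>_ n. ennreal (real n)" "\<lambda>_. borel"] A
    by auto
  then have "(\<integral>\<^sup>+\<omega>. (\<Prod>i<k. ennreal (real (card (N \<omega> \<inter> A i)))) \<partial>M) = (\<Prod>i<k. emeasure \<rho> (A i))"
    by (subst indep_vars_nn_integral) (auto simp: nn_integral_count A)
  then show "(\<integral>\<^sup>+\<omega>. (\<Sum>x\<in>distinct_tuples k (N \<omega>). indicator (PiE {..<k} A) x) \<partial>M) =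
      emeasure (PiM {..<k} (\<lambda>_. \<rho>)) (PiE {..<k} A)"
    using A by (subst emeasure_PiM) (auto simp: eq cong: nn_integral_cong)
qed

text \<open>The Dynkin argument needs the whole off-diagonal space, which in general is no rectangle
  with disjoint sides. Its tuples are counted by the falling factorial of the total count
  instead.\<close>

lemma factorial_moment_total:
  shows "(\<lambda>\<omega>. \<Sum>x\<in>distinct_tuples k (N \<omega>). 1 :: ennreal) \<in> borel_measurable M"
    and "(\<integral>\<^sup>+\<omega>. (\<Sum>x\<in>distinct_tuples k (N \<omega>). 1) \<partial>M) = emeasure \<rho> UNIV ^ k"
proof -
  have eq: "(\<Sum>x\<in>distinct_tuples k (N \<omega>). 1) = ennreal (real (\<Prod>i<k. card (N \<omega> \<inter> UNIV) - i))"
    if "\<omega> \<in> space M" for \<omega>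
    using card_distinct_tuples[OF finite_points[OF that], of k]
    by (simp add: ennreal_of_nat_eq_real_of_nat)
  show "(\<lambda>\<omega>. \<Sum>x\<in>distinct_tuples k (N \<omega>). 1 :: ennreal) \<in> borel_measurable M"
    using measurable_compose[OF measurable_count[of UNIV], of "\<lambda>n. ennreal (real (\<Prod>i<k. n - i))" borel]
    by (subst measurable_cong[OF eq]) auto
  show "(\<integral>\<^sup>+\<omega>. (\<Sum>x\<in>distinct_tuples k (N \<omega>). 1) \<partial>M) = emeasure \<rho> UNIV ^ k"
    using nn_integral_falling_factorial_poisson[OF measurable_count prob_count, of UNIV k]
    by (subst nn_integral_cong[OF eq])
      (simp_all add: intensity.emeasure_eq_measure ennreal_power del: of_nat_prod)
qed

lemma factorial_moment_indicator:
  assumes B: "B \<in> sets (PiM {..<k} (\<lambda>_. borel))"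
  shows "(\<lambda>\<omega>. \<Sum>x\<in>distinct_tuples k (N \<omega>). indicator B x :: ennreal) \<in> borel_measurable M \<and>
    (\<integral>\<^sup>+\<omega>. (\<Sum>x\<in>distinct_tuples k (N \<omega>). indicator B x) \<partial>M) = emeasure (PiM {..<k} (\<lambda>_. \<rho>)) B"
proof -
  let ?C = "\<lambda>B \<omega>. \<Sum>x\<in>distinct_tuples k (N \<omega>). indicator B x :: ennreal"
  let ?P = "PiM {..<k} (\<lambda>_. \<rho>)"
  define \<Omega> :: "(nat \<Rightarrow> 'a) set" where "\<Omega> = {x \<in> {..<k} \<rightarrow>\<^sub>E UNIV. inj_on x {..<k}}"
  define G :: "(nat \<Rightarrow> 'a) set set" where
    "G = {PiE {..<k} A | A. (\<forall>i<k. A i \<in> sets borel) \<and> disjoint_family_on A {..<k}}"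
  have GO: "G \<subseteq> Pow \<Omega>"
  proof
    fix R assume "R \<in> G"
    then obtain A where "R = PiE {..<k} A" "disjoint_family_on A {..<k}" by (auto simp: G_def)
    then have "R = distinct_tuples k UNIV \<inter> R" using distinct_tuples_Int_PiE[of A k UNIV] by simp
    then show "R \<in> Pow \<Omega>" by (auto simp: \<Omega>_def distinct_tuples_def)
  qed
  have Gs: "G \<subseteq> sets ?P" by (auto simp: G_def intro!: sets_PiM_I_finite)
  have Int: "Int_stable G"
  proof (rule Int_stableI)
    fix R S assume "R \<in> G" "S \<in> G"
    then obtain A A' where A: "R = PiE {..<k} A" "\<forall>i<k. A i \<in> sets borel" "disjoint_family_on A {..<k}"
      and A': "S = PiE {..<k} A'" "\<forall>i<k. A' i \<in> sets borel" by (auto simp: G_def)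
    have "R \<inter> S = PiE {..<k} (\<lambda>i. A i \<inter> A' i)" by (auto simp: A A' PiE_iff)
    moreover have "disjoint_family_on (\<lambda>i. A i \<inter> A' i) {..<k}"
      using A(3) by (auto simp: disjoint_family_on_def)
    ultimately show "R \<inter> S \<in> G" using A(2) A'(2)
      unfolding G_def by (intro CollectI exI[of _ "\<lambda>i. A i \<inter> A' i"]) auto
  qed
  have Om: "\<Omega> \<in> sets ?P"
  proof -
    have "\<Omega> = space ?P - (\<Union>i\<in>{..<k}. \<Union>j\<in>{..<k} - {i}. {x \<in> space ?P. x i = x j})"
      by (auto simp: \<Omega>_def space_PiM inj_on_def)
    also have "\<dots> \<in> sets ?P"
      by (intro sets.Diff sets.top sets.finite_UN measurable_diagonal) auto
    finally show ?thesis .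
  qed
  have sigma_le: "sigma_sets \<Omega> G \<subseteq> sets ?P"
  proof
    fix R assume "R \<in> sigma_sets \<Omega> G"
    then show "R \<in> sets ?P"
      by (induction rule: sigma_sets.induct) (use Gs Om in auto)
  qed
  have AEO: "AE x in ?P. x \<in> \<Omega>"
    using AE_inj[of k] AE_space by eventually_elim (auto simp: \<Omega>_def space_PiM)
  have vol_Om: "emeasure ?P \<Omega> = emeasure \<rho> UNIV ^ k"
  proof -
    have "emeasure ?P \<Omega> = emeasure ?P (space ?P)"
      using AEO Om by (intro emeasure_eq_AE) (auto simp: \<Omega>_def space_PiM)
    also have "\<dots> = emeasure \<rho> UNIV ^ k"
      by (simp add: space_PiM emeasure_PiM)
    finally show ?thesis .
  qed
  have TO: "x \<in> \<Omega>" if "x \<in> distinct_tuples k X" for x and X :: "'a set"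
    using that unfolding distinct_tuples_def \<Omega>_def PiE_iff by simp
  have C_Om: "?C \<Omega> \<omega> = (\<Sum>x\<in>distinct_tuples k (N \<omega>). 1)" for \<omega>
    by (intro sum.cong refl indicator_simps(1) TO)
  have fin_Om: "emeasure \<rho> UNIV ^ k < \<infinity>"
    by (simp add: intensity.emeasure_eq_measure ennreal_power)
  \<comment> \<open>Rectangles with disjoint sides are stable under intersection, so it suffices to
    close the class of good sets under complements in \<open>\<Omega>\<close> and countable disjoint
    unions.\<close>
  have main: "?C R \<in> borel_measurable M \<and> (\<integral>\<^sup>+\<omega>. ?C R \<omega> \<partial>M) = emeasure ?P R"
    if "R \<in> sigma_sets \<Omega> G" for R
    using Int GO that
  proof (induction rule: sigma_sets_induct_disjoint)
    case (basic R)
    then show ?case using factorial_moment_disjoint_rectangle by (auto simp: G_def)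
  next
    case empty
    then show ?case by simp
  next
    case (compl R)
    have sub: "R \<subseteq> \<Omega>" using sigma_sets_into_sp[OF GO compl.hyps] .
    \<comment> \<open>Complements are handled by subtraction, which is legitimate because the total
      \<open>emeasure \<rho> UNIV ^ k\<close> is finite.\<close>
    have split: "?C \<Omega> \<omega> = ?C R \<omega> + ?C (\<Omega> - R) \<omega>" for \<omega>
      using sub by (subst sum.distrib[symmetric]) (auto intro!: sum.cong simp: indicator_def)
    have finC: "?C R \<omega> \<noteq> \<infinity>" for \<omega>
      by (cases "finite (distinct_tuples k (N \<omega>))") (auto simp: indicator_def)
    have eq: "?C (\<Omega> - R) = (\<lambda>\<omega>. ?C \<Omega> \<omega> - ?C R \<omega>)"
      using finC by (auto simp: split fun_eq_iff)
    have m: "?C (\<Omega> - R) \<in> borel_measurable M"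
      unfolding eq using compl.IH factorial_moment_total(1)[of k] by (auto simp: C_Om)
    have "(\<integral>\<^sup>+\<omega>. ?C R \<omega> \<partial>M) + (\<integral>\<^sup>+\<omega>. ?C (\<Omega> - R) \<omega> \<partial>M) = (\<integral>\<^sup>+\<omega>. ?C \<Omega> \<omega> \<partial>M)"
      unfolding split using compl.IH m by (intro nn_integral_add[symmetric]) auto
    also have "\<dots> = emeasure ?P \<Omega>"
      by (simp only: C_Om factorial_moment_total vol_Om)
    also have "\<dots> = emeasure ?P R + emeasure ?P (\<Omega> - R)"
      using sigma_le compl.hyps Om sub by (subst plus_emeasure) (auto simp: Un_absorb1)
    finally have "emeasure ?P R + (\<integral>\<^sup>+\<omega>. ?C (\<Omega> - R) \<omega> \<partial>M) = emeasure ?P R + emeasure ?P (\<Omega> - R)"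
      using compl.IH by simp
    moreover have "emeasure ?P R \<noteq> \<infinity>"
      using emeasure_mono[OF sub Om] fin_Om vol_Om by auto
    ultimately show ?case using m by (auto simp: ennreal_add_left_cancel)
  next
    case (union R)
    have eq: "?C (\<Union>i. R i) \<omega> = (\<Sum>i. ?C (R i) \<omega>)" if "\<omega> \<in> space M" for \<omega>
      using union.hyps(1) by (subst suminf_sum) (auto simp: suminf_indicator intro!: sum.cong)
    have m: "?C (\<Union>i. R i) \<in> borel_measurable M"
      using union.IH by (subst measurable_cong[OF eq]) (auto intro!: borel_measurable_suminf_order)
    have "(\<integral>\<^sup>+\<omega>. ?C (\<Union>i. R i) \<omega> \<partial>M) = (\<Sum>i. (\<integral>\<^sup>+\<omega>. ?C (R i) \<omega> \<partial>M))"
      using union.IH by (subst nn_integral_suminf[symmetric]) (auto simp: eq cong: nn_integral_cong)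
    also have "\<dots> = (\<Sum>i. emeasure ?P (R i))" using union.IH by simp
    also have "\<dots> = emeasure ?P (\<Union>i. R i)"
      using union.hyps sigma_le by (intro suminf_emeasure) auto
    finally show ?case using m by simp
  qed
  \<comment> \<open>Both sides ignore the diagonals: no tuple of distinct points lies there, and the
    product measure gives them mass 0.\<close>
  have "?C B = ?C (B \<inter> \<Omega>)"
    using TO by (intro ext sum.cong refl) (simp add: indicator_def)
  moreover have "emeasure ?P B = emeasure ?P (B \<inter> \<Omega>)"
  proof (rule emeasure_eq_AE)
    show "AE x in ?P. x \<in> B \<longleftrightarrow> x \<in> B \<inter> \<Omega>" using AEO by eventually_elim auto
  qed (use B Om in auto)
  moreover have "B \<inter> \<Omega> \<in> sigma_sets \<Omega> G"
    using off_diagonal_in_sigma_sets[OF B] by (simp add: \<Omega>_def G_def)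
  ultimately show ?thesis using main[of "B \<inter> \<Omega>"] by simp
qed

text \<open>Induction over nonnegative measurable functions. Measurability of the sum stays in the
  conclusion because it has to be carried along from indicators.\<close>

lemma factorial_moment_nn_integral:
  fixes f :: "(nat \<Rightarrow> 'a) \<Rightarrow> ennreal"
  assumes "f \<in> borel_measurable (PiM {..<k} (\<lambda>_. \<rho>))"
  shows "(\<lambda>\<omega>. \<Sum>x\<in>distinct_tuples k (N \<omega>). f x) \<in> borel_measurable M \<and>
    (\<integral>\<^sup>+\<omega>. (\<Sum>x\<in>distinct_tuples k (N \<omega>). f x) \<partial>M) = (\<integral>\<^sup>+x. f x \<partial>PiM {..<k} (\<lambda>_. \<rho>))"
  using assms
proof (induction rule: borel_measurable_induct)
  case (cong f g)
  have "x \<in> space (PiM {..<k} (\<lambda>_. \<rho>))" if "x \<in> distinct_tuples k X" for x X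
    using that by (auto simp: distinct_tuples_def space_PiM PiE_iff)
  then have "(\<Sum>x\<in>distinct_tuples k (N \<omega>). f x) = (\<Sum>x\<in>distinct_tuples k (N \<omega>). g x)" for \<omega>
    using cong.hyps by (intro sum.cong) auto
  then show ?case using cong by (simp cong: nn_integral_cong)
next
  case (set B)
  then show ?case using factorial_moment_indicator[of B k] by simp
next
  case (mult f c)
  then show ?case by (auto simp: sum_distrib_left[symmetric] nn_integral_cmult)
next
  case (add f g)
  then show ?case by (auto simp: sum.distrib nn_integral_add)
next
  case (seq U)
  have inc: "incseq (\<lambda>i. U i x)" for x using seq.hyps by (auto simp: incseq_def le_fun_def)
  have eq: "(\<Sum>x\<in>distinct_tuples k (N \<omega>). (SUP i. U i) x) = (SUP i. \<Sum>x\<in>distinct_tuples k (N \<omega>). U i x)" for \<omega>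
    using inc by (subst ennreal_SUP_sum) (auto simp: image_comp)
  have inc': "incseq (\<lambda>i \<omega>. \<Sum>x\<in>distinct_tuples k (N \<omega>). U i x)"
    using inc by (auto simp: incseq_def le_fun_def intro!: sum_mono)
  have "(\<integral>\<^sup>+\<omega>. (SUP i. \<Sum>x\<in>distinct_tuples k (N \<omega>). U i x) \<partial>M) =
      (SUP i. \<integral>\<^sup>+x. U i x \<partial>PiM {..<k} (\<lambda>_. \<rho>))"
    using seq.IH inc' by (subst nn_integral_monotone_convergence_SUP) auto
  also have "\<dots> = (\<integral>\<^sup>+x. (SUP i. U i) x \<partial>PiM {..<k} (\<lambda>_. \<rho>))"
    using seq.hyps by (subst nn_integral_monotone_convergence_SUP[symmetric]) (auto simp: SUP_apply[abs_def])
  finally show ?case unfolding eq using seq.IH by (auto intro!: borel_measurable_SUP)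
qed

lemma factorial_moment_nonneg:
  fixes f :: "(nat \<Rightarrow> 'a) \<Rightarrow> real"
  assumes f: "integrable (PiM {..<k} (\<lambda>_. \<rho>)) f" and nonneg: "\<And>x. 0 \<le> f x"
  shows "has_bochner_integral M (\<lambda>\<omega>. \<Sum>x\<in>distinct_tuples k (N \<omega>). f x)
    (\<integral>x. f x \<partial>PiM {..<k} (\<lambda>_. \<rho>))"
proof -
  have eq: "ennreal (\<Sum>x\<in>distinct_tuples k (N \<omega>). f x) = (\<Sum>x\<in>distinct_tuples k (N \<omega>). ennreal (f x))" for \<omega>
    using nonneg by simp
  have [measurable]: "f \<in> borel_measurable (PiM {..<k} (\<lambda>_. \<rho>))" using f by auto
  have nn: "(\<lambda>\<omega>. \<Sum>x\<in>distinct_tuples k (N \<omega>). ennreal (f x)) \<in> borel_measurable M"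
    "(\<integral>\<^sup>+\<omega>. (\<Sum>x\<in>distinct_tuples k (N \<omega>). ennreal (f x)) \<partial>M) = (\<integral>\<^sup>+x. ennreal (f x) \<partial>PiM {..<k} (\<lambda>_. \<rho>))"
    using factorial_moment_nn_integral[of "\<lambda>x. ennreal (f x)" k] by auto
  have "(\<lambda>\<omega>. enn2real (\<Sum>x\<in>distinct_tuples k (N \<omega>). ennreal (f x))) \<in> borel_measurable M"
    using nn(1) by measurable
  then have "(\<lambda>\<omega>. \<Sum>x\<in>distinct_tuples k (N \<omega>). f x) \<in> borel_measurable M"
    unfolding eq[symmetric] using nonneg by (simp add: sum_nonneg)
  then show ?thesis
    using nn(2) f nonneg
    by (intro has_bochner_integral_nn_integral) (auto simp: eq nn_integral_eq_integral sum_nonneg simp del: sum_ennreal)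
qed

text \<open>The multivariate Campbell-Mecke formula for integrands that depend on the tuple alone,
  obtained from positive and negative parts.\<close>

theorem factorial_moment:
  fixes f :: "(nat \<Rightarrow> 'a) \<Rightarrow> real"
  assumes f: "integrable (PiM {..<k} (\<lambda>_. \<rho>)) f"
  shows "has_bochner_integral M (\<lambda>\<omega>. \<Sum>x\<in>distinct_tuples k (N \<omega>). f x)
    (\<integral>x. f x \<partial>PiM {..<k} (\<lambda>_. \<rho>))"
proof -
  have int: "integrable (PiM {..<k} (\<lambda>_. \<rho>)) (\<lambda>x. max 0 (f x))"
    "integrable (PiM {..<k} (\<lambda>_. \<rho>)) (\<lambda>x. max 0 (- f x))"
    using f by auto
  have split: "f x = max 0 (f x) - max 0 (- f x)" for x by simp
  have "(\<integral>x. f x \<partial>PiM {..<k} (\<lambda>_. \<rho>)) =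
      (\<integral>x. max 0 (f x) \<partial>PiM {..<k} (\<lambda>_. \<rho>)) - (\<integral>x. max 0 (- f x) \<partial>PiM {..<k} (\<lambda>_. \<rho>))"
    using int by (subst split) simp
  moreover have "(\<Sum>x\<in>Y. f x) = (\<Sum>x\<in>Y. max 0 (f x)) - (\<Sum>x\<in>Y. max 0 (- f x))" for Y
    by (subst split) (simp add: sum_subtractf)
  ultimately show ?thesis
    using has_bochner_integral_diff[OF factorial_moment_nonneg[OF int(1)] factorial_moment_nonneg[OF int(2)]]
    by simp
qed

section \<open>Functions of one or two coordinates on a power of the intensity\<close>

lemma integrable_PiM_component:
  fixes g :: "'a \<Rightarrow> real" and i k :: nat
  assumes g: "integrable \<rho> g" and i: "i < k"
  shows "integrable (PiM {..<k} (\<lambda>_. \<rho>)) (\<lambda>x. g (x i))"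
proof -
  let ?J = "{..<k} - {i}"
  have k: "{..<k} = insert i ?J" using i by auto
  have [measurable]: "g \<in> borel_measurable \<rho>" using g by auto
  have m: "(\<lambda>x. g (x i)) \<in> borel_measurable (PiM {..<k} (\<lambda>_. \<rho>))"
    using i by (intro measurable_compose[OF measurable_component_singleton[of i]]) auto
  have m1: "(\<lambda>x. ennreal (norm (g (x i)))) \<in> borel_measurable (PiM (insert i ?J) (\<lambda>_. \<rho>))"
    using m unfolding k[symmetric] by measurable
  have "(\<integral>\<^sup>+x. ennreal (norm (g (x i))) \<partial>PiM (insert i ?J) (\<lambda>_. \<rho>)) =
      (\<integral>\<^sup>+x. (\<integral>\<^sup>+y. ennreal (norm (g y)) \<partial>\<rho>) \<partial>PiM ?J (\<lambda>_. \<rho>))"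
    by (subst product_nn_integral_insert[OF _ _ m1]) auto
  \<comment> \<open>Each coordinate that does not occur contributes a factor
    \<open>emeasure \<rho> UNIV\<close>, which is finite.\<close>
  also have "\<dots> = (\<integral>\<^sup>+y. ennreal (norm (g y)) \<partial>\<rho>) * emeasure \<rho> UNIV ^ card ?J"
    by (simp add: space_PiM emeasure_PiM)
  also have "\<dots> < \<infinity>"
    using g by (auto simp: integrable_iff_bounded intensity.emeasure_eq_measure ennreal_power
        ennreal_mult_less_top)
  finally show ?thesis
    using m unfolding k[symmetric] integrable_iff_bounded by simp
qed

lemma integrable_PiM_pair:
  fixes h :: "'a \<Rightarrow> 'a \<Rightarrow> real" and i j k :: nat
  assumes h: "integrable (\<rho> \<Otimes>\<^sub>M \<rho>) (\<lambda>(x, y). h x y)" and ij: "i < k" "j < k" "i \<noteq> j"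
  shows "integrable (PiM {..<k} (\<lambda>_. \<rho>)) (\<lambda>x. h (x i) (x j))"
proof -
  let ?J = "{..<k} - {i}" and ?L = "{..<k} - {i} - {j}"
  have k: "{..<k} = insert i ?J" "?J = insert j ?L" using ij by auto
  have [measurable]: "(\<lambda>(x, y). h x y) \<in> borel_measurable (\<rho> \<Otimes>\<^sub>M \<rho>)" using h by auto
  have m: "(\<lambda>x. h (x i) (x j)) \<in> borel_measurable (PiM {..<k} (\<lambda>_. \<rho>))"
  proof -
    have "(\<lambda>x. (x i, x j)) \<in> measurable (PiM {..<k} (\<lambda>_. \<rho>)) (\<rho> \<Otimes>\<^sub>M \<rho>)"
      using ij by (intro measurable_Pair measurable_component_singleton) auto
    from measurable_compose[OF this, of "\<lambda>(x, y). h x y" borel] show ?thesis by simp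
  qed
  have m1: "(\<lambda>x. ennreal (norm (h (x i) (x j)))) \<in> borel_measurable (PiM (insert i ?J) (\<lambda>_. \<rho>))"
    using m unfolding k(1)[symmetric] by measurable
  have m2: "(\<lambda>x. \<integral>\<^sup>+y. ennreal (norm (h y (x j))) \<partial>\<rho>) \<in> borel_measurable (PiM (insert j ?L) (\<lambda>_. \<rho>))"
    by measurable
  have "(\<integral>\<^sup>+x. ennreal (norm (h (x i) (x j))) \<partial>PiM (insert i ?J) (\<lambda>_. \<rho>)) =
      (\<integral>\<^sup>+x. (\<integral>\<^sup>+y. ennreal (norm (h y (x j))) \<partial>\<rho>) \<partial>PiM ?J (\<lambda>_. \<rho>))"
    using ij by (subst product_nn_integral_insert[OF _ _ m1]) auto
  also have "\<dots> = (\<integral>\<^sup>+x. (\<integral>\<^sup>+y. (\<integral>\<^sup>+z. ennreal (norm (h z y)) \<partial>\<rho>) \<partial>\<rho>) \<partial>PiM ?L (\<lambda>_. \<rho>))"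
    by (subst k(2), subst product_nn_integral_insert[OF _ _ m2]) auto
  also have "\<dots> = (\<integral>\<^sup>+y. (\<integral>\<^sup>+z. ennreal (norm (h z y)) \<partial>\<rho>) \<partial>\<rho>) * emeasure \<rho> UNIV ^ card ?L"
    by (simp add: space_PiM emeasure_PiM)
  also have "(\<integral>\<^sup>+y. (\<integral>\<^sup>+z. ennreal (norm (h z y)) \<partial>\<rho>) \<partial>\<rho>) =
      (\<integral>\<^sup>+p. ennreal (norm (case p of (x, y) \<Rightarrow> h x y)) \<partial>(\<rho> \<Otimes>\<^sub>M \<rho>))"
    using pair_sigma_finite.nn_integral_snd[of \<rho> \<rho> "\<lambda>p. ennreal (norm (case p of (x, y) \<Rightarrow> h x y))"]
    by (simp add: pair_sigma_finite_def intensity.sigma_finite_measure_axioms)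
  also have "\<dots> * emeasure \<rho> UNIV ^ card ?L < \<infinity>"
    using h by (auto simp: integrable_iff_bounded intensity.emeasure_eq_measure ennreal_power
        ennreal_mult_less_top)
  finally show ?thesis
    using m unfolding k(1)[symmetric] integrable_iff_bounded by simp
qed

end

section \<open>Variance of a pair sum\<close>

context poisson_process
begin

lemma integral_PiM_Suc:
  fixes F :: "(nat \<Rightarrow> 'a) \<Rightarrow> real"
  assumes "integrable (PiM {..<Suc k} (\<lambda>_. \<rho>)) F"
  shows "(\<integral>x. F x \<partial>PiM {..<Suc k} (\<lambda>_. \<rho>)) = (\<integral>x. (\<integral>a. F (x(k := a)) \<partial>\<rho>) \<partial>PiM {..<k} (\<lambda>_. \<rho>))"
  using product_integral_insert[of "{..<k}" k F] assms by (simp add: lessThan_Suc)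

lemma pair_sigma_finite_intensity: "pair_sigma_finite \<rho> \<rho>"
  by (simp add: pair_sigma_finite_def intensity.sigma_finite_measure_axioms)

text \<open>On a finite measure space square integrability implies integrability, and section
  integrals inherit it through Cauchy-Schwarz in \<open>y\<close>, with the constant
  \<open>c + 1\<close> in place of the total mass \<open>c\<close>.\<close>

lemma
  fixes f :: "'a \<Rightarrow> 'a \<Rightarrow> real"
  assumes meas: "(\<lambda>(x, y). f x y) \<in> borel_measurable (\<rho> \<Otimes>\<^sub>M \<rho>)"
    and sq: "integrable (\<rho> \<Otimes>\<^sub>M \<rho>) (\<lambda>(x, y). (f x y)\<^sup>2)"
  shows square_integrable_pair: "integrable (\<rho> \<Otimes>\<^sub>M \<rho>) (\<lambda>(x, y). f x y)"
    and square_integrable_section: "integrable \<rho> (\<lambda>x. (\<integral>y. f x y \<partial>\<rho>)\<^sup>2)"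
proof -
  note [measurable] = meas
  interpret pair_sigma_finite \<rho> \<rho> by (rule pair_sigma_finite_intensity)
  interpret P: finite_measure "\<rho> \<Otimes>\<^sub>M \<rho>"
    by (intro finite_measure_pair_measure) unfold_locales
  have sq': "integrable (\<rho> \<Otimes>\<^sub>M \<rho>) (\<lambda>p. (case p of (x, y) \<Rightarrow> f x y)\<^sup>2)"
    using sq by (simp add: case_prod_unfold)
  show int: "integrable (\<rho> \<Otimes>\<^sub>M \<rho>) (\<lambda>(x, y). f x y)"
    using P.square_integrable_imp_integrable[OF meas sq'] .
  define c where "c = measure \<rho> UNIV"
  have c: "0 \<le> c" by (simp add: c_def)
  have Q: "integrable \<rho> (\<lambda>x. \<integral>y. (f x y)\<^sup>2 \<partial>\<rho>)"
    using integrable_fst[OF sq] by simp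
  have "AE x in \<rho>. (\<integral>y. f x y \<partial>\<rho>)\<^sup>2 \<le> (c + 1) * (\<integral>y. (f x y)\<^sup>2 \<partial>\<rho>)"
    using AE_integrable_fst[OF sq] AE_integrable_fst[OF int]
  proof eventually_elim
    case (elim x)
    define g where "g = (\<integral>y. f x y \<partial>\<rho>)"
    define q where "q = (\<integral>y. (f x y)\<^sup>2 \<partial>\<rho>)"
    \<comment> \<open>Nearly the mean of \<open>f x\<close>; expanding the integral of
      \<open>(f x y - s)\<^sup>2\<close> gives the inequality. Dividing by \<open>c + 1\<close>
      instead of \<open>c\<close> covers the zero measure.\<close>
    define s where "s = g / (c + 1)"
    have "0 \<le> (\<integral>y. (f x y - s)\<^sup>2 \<partial>\<rho>)" by (intro integral_nonneg_AE) auto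
    also have "(\<integral>y. (f x y - s)\<^sup>2 \<partial>\<rho>) = (\<integral>y. (f x y)\<^sup>2 - 2 * s * f x y + s\<^sup>2 \<partial>\<rho>)"
      by (intro Bochner_Integration.integral_cong) (auto simp: power2_eq_square algebra_simps)
    also have "\<dots> = q - 2 * s * g + s\<^sup>2 * c"
      using elim by (simp add: q_def g_def c_def intensity.emeasure_eq_measure mult.commute)
    finally have "2 * s * g \<le> q + s\<^sup>2 * c" by simp
    moreover have "s * g = s\<^sup>2 * (c + 1)" using c by (simp add: s_def power2_eq_square)
    ultimately have "s\<^sup>2 * (c + 1) + s\<^sup>2 \<le> q" by (simp add: algebra_simps)
    then have "s\<^sup>2 * (c + 1) \<le> q" using zero_le_power2[of s] by linarith
    then have "(c + 1) * (s\<^sup>2 * (c + 1)) \<le> (c + 1) * q" using c by (intro mult_left_mono) auto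
    moreover have "(c + 1) * (s\<^sup>2 * (c + 1)) = g\<^sup>2" using c by (simp add: s_def power2_eq_square)
    ultimately show ?case by (simp add: g_def q_def)
  qed
  then show "integrable \<rho> (\<lambda>x. (\<integral>y. f x y \<partial>\<rho>)\<^sup>2)"
    using Q by (intro Bochner_Integration.integrable_bound[OF integrable_mult_right[OF Q, of "c + 1"]])
      (auto elim!: eventually_mono)
qed

text \<open>In the expectation of \<open>pair_sum_squared\<close>, the sum over quadruples
  contributes the square of the mean and drops out of the variance. The pairs sharing one or two
  points remain, with their coefficients 4 and 2.\<close>

theorem pair_sum_variance:
  fixes f :: "'a \<Rightarrow> 'a \<Rightarrow> real"
  assumes meas: "(\<lambda>(x, y). f x y) \<in> borel_measurable (\<rho> \<Otimes>\<^sub>M \<rho>)"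
    and sym: "\<And>x y. f x y = f y x" and diag: "\<And>x. f x x = 0"
    and sq: "integrable (\<rho> \<Otimes>\<^sub>M \<rho>) (\<lambda>(x, y). (f x y)\<^sup>2)"
  defines "S \<equiv> \<lambda>\<omega>. \<Sum>x\<in>distinct_tuples 2 (N \<omega>). f (x 0) (x 1)"
  shows "integrable M S" and "integrable M (\<lambda>\<omega>. (S \<omega>)\<^sup>2)"
    and "variance S = 4 * (\<integral>x. (\<integral>y. f x y \<partial>\<rho>)\<^sup>2 \<partial>\<rho>) + 2 * (\<integral>x. (\<integral>y. (f x y)\<^sup>2 \<partial>\<rho>) \<partial>\<rho>)"
proof -
  note [measurable] = meas
  let ?P = "\<lambda>k. PiM {..<k} (\<lambda>_::nat. \<rho>)"
  define G where "G x = (\<integral>y. f x y \<partial>\<rho>)" for x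
  define Q where "Q x = (\<integral>y. (f x y)\<^sup>2 \<partial>\<rho>)" for x
  interpret pair_sigma_finite \<rho> \<rho> by (rule pair_sigma_finite_intensity)
  have f_int: "integrable (\<rho> \<Otimes>\<^sub>M \<rho>) (\<lambda>(x, y). f x y)"
    by (rule square_integrable_pair[OF meas sq])
  have G2: "integrable \<rho> (\<lambda>x. (G x)\<^sup>2)"
    unfolding G_def by (rule square_integrable_section[OF meas sq])
  have Gm [measurable]: "G \<in> borel_measurable \<rho>" unfolding G_def by measurable
  have G1: "integrable \<rho> G"
    using intensity.square_integrable_imp_integrable[OF Gm G2] .
  have Q1: "integrable \<rho> Q" unfolding Q_def using integrable_fst[OF sq] by simp
  have mf: "(\<lambda>x. f (x i) (x j)) \<in> borel_measurable (?P k)" if "i < k" "j < k" "i \<noteq> j" for i j k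
    using integrable_PiM_pair[OF f_int that] by auto
  have mG: "(\<lambda>x. G (x i)) \<in> borel_measurable (?P k)" if "i < k" for i k
    using integrable_PiM_component[OF G1 that] by auto
  \<comment> \<open>Since \<open>|u v|\<close> is at most \<open>u\<^sup>2 + v\<^sup>2\<close>,
    square integrable factors have an integrable product; this covers the products of
    \<open>f\<close> and \<open>G\<close> below.\<close>
  have prod: "integrable (?P k) (\<lambda>x. u x * v x)"
    if "u \<in> borel_measurable (?P k)" "v \<in> borel_measurable (?P k)"
      "integrable (?P k) (\<lambda>x. (u x)\<^sup>2)" "integrable (?P k) (\<lambda>x. (v x)\<^sup>2)"
    for k and u v :: "(nat \<Rightarrow> 'a) \<Rightarrow> real"
  proof (rule Bochner_Integration.integrable_bound)
    show "integrable (?P k) (\<lambda>x. (u x)\<^sup>2 + (v x)\<^sup>2)" using that by simp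
    show "AE x in ?P k. norm (u x * v x) \<le> norm ((u x)\<^sup>2 + (v x)\<^sup>2)"
    proof (rule AE_I2)
      fix x
      have "2 * (\<bar>u x\<bar> * \<bar>v x\<bar>) \<le> (u x)\<^sup>2 + (v x)\<^sup>2"
        using sum_squares_bound[of "\<bar>u x\<bar>" "\<bar>v x\<bar>"] by simp
      moreover have "0 \<le> \<bar>u x\<bar> * \<bar>v x\<bar>" by simp
      ultimately have "\<bar>u x\<bar> * \<bar>v x\<bar> \<le> (u x)\<^sup>2 + (v x)\<^sup>2" by linarith
      then show "norm (u x * v x) \<le> norm ((u x)\<^sup>2 + (v x)\<^sup>2)"
        by (simp add: abs_mult)
    qed
  qed (use that in measurable)
  have f2: "integrable (?P k) (\<lambda>x. (f (x i) (x j))\<^sup>2)" if "i < k" "j < k" "i \<noteq> j" for i j k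
    using integrable_PiM_pair[of "\<lambda>x y. (f x y)\<^sup>2", OF sq that] .
  have Gk2: "integrable (?P k) (\<lambda>x. (G (x i))\<^sup>2)" if "i < k" for i k
    using integrable_PiM_component[OF G2 that] .
  have P1: "(\<integral>x. g (x 0) \<partial>?P 1) = integral\<^sup>L \<rho> g" if "integrable \<rho> g" for g :: "'a \<Rightarrow> real"
    using product_integral_singleton[of g 0] that by (simp add: lessThan_Suc)
  have I2: "(\<integral>x. f (x 0) (x 1) \<partial>?P 2) = integral\<^sup>L \<rho> G"
    using integral_PiM_Suc[of 1 "\<lambda>x. f (x 0) (x 1)"] integrable_PiM_pair[OF f_int, of 0 2 1] P1[OF G1]
    by (simp add: G_def numeral_2_eq_2)
  have I22: "(\<integral>x. (f (x 0) (x 1))\<^sup>2 \<partial>?P 2) = integral\<^sup>L \<rho> Q"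
    using integral_PiM_Suc[of 1 "\<lambda>x. (f (x 0) (x 1))\<^sup>2"] f2[of 0 2 1] P1[OF Q1]
    by (simp add: Q_def numeral_2_eq_2)
  have i3: "integrable (?P 3) (\<lambda>x. f (x 0) (x 1) * f (x 0) (x 2))"
    by (intro prod mf f2) auto
  have i4: "integrable (?P 4) (\<lambda>x. f (x 0) (x 1) * f (x 2) (x 3))"
    by (intro prod mf f2) auto
  \<comment> \<open>Given \<open>x 0\<close>, the other two points are integrated out one after the
    other, each giving \<open>G (x 0)\<close>.\<close>
  have I3: "(\<integral>x. f (x 0) (x 1) * f (x 0) (x 2) \<partial>?P 3) = (\<integral>x. (G x)\<^sup>2 \<partial>\<rho>)"
  proof -
    have "(\<integral>x. f (x 0) (x 1) * f (x 0) (x 2) \<partial>?P 3) = (\<integral>x. f (x 0) (x 1) * G (x 0) \<partial>?P 2)"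
      using integral_PiM_Suc[of 2 "\<lambda>x. f (x 0) (x 1) * f (x 0) (x 2)"] i3
      by (simp add: G_def numeral_3_eq_3 numeral_2_eq_2)
    also have "\<dots> = (\<integral>x. G (x 0) * G (x 0) \<partial>?P 1)"
      using integral_PiM_Suc[of 1 "\<lambda>x. f (x 0) (x 1) * G (x 0)"]
        prod[OF mf mG f2 Gk2, of 0 2 1 0]
      by (simp add: G_def numeral_2_eq_2)
    also have "\<dots> = (\<integral>x. (G x)\<^sup>2 \<partial>\<rho>)"
      using P1[OF G2] by (simp add: power2_eq_square)
    finally show ?thesis .
  qed
  \<comment> \<open>The two pairs have no common point, so the integral factorises.\<close>
  have I4: "(\<integral>x. f (x 0) (x 1) * f (x 2) (x 3) \<partial>?P 4) = (integral\<^sup>L \<rho> G)\<^sup>2"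
  proof -
    have 4: "(4::nat) = Suc 3" "(3::nat) = Suc 2" by auto
    have "(\<integral>x. f (x 0) (x 1) * f (x 2) (x 3) \<partial>?P 4) = (\<integral>x. f (x 0) (x 1) * G (x 2) \<partial>?P 3)"
      using integral_PiM_Suc[of 3 "\<lambda>x. f (x 0) (x 1) * f (x 2) (x 3)"] i4
      by (simp add: G_def 4(1)[symmetric])
    also have "\<dots> = (\<integral>x. f (x 0) (x 1) * integral\<^sup>L \<rho> G \<partial>?P 2)"
      using integral_PiM_Suc[of 2 "\<lambda>x. f (x 0) (x 1) * G (x 2)"]
        prod[OF mf mG f2 Gk2, of 0 3 1 2]
      by (simp add: 4(2)[symmetric])
    also have "\<dots> = (integral\<^sup>L \<rho> G)\<^sup>2"
      using I2 by (simp add: power2_eq_square)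
    finally show ?thesis .
  qed
  have ES: "has_bochner_integral M S (integral\<^sup>L \<rho> G)"
    unfolding S_def I2[symmetric] by (intro factorial_moment integrable_PiM_pair f_int) auto
  have "has_bochner_integral M (\<lambda>\<omega>. (\<Sum>x\<in>distinct_tuples 4 (N \<omega>). f (x 0) (x 1) * f (x 2) (x 3)) +
      4 * (\<Sum>x\<in>distinct_tuples 3 (N \<omega>). f (x 0) (x 1) * f (x 0) (x 2)) +
      2 * (\<Sum>x\<in>distinct_tuples 2 (N \<omega>). (f (x 0) (x 1))\<^sup>2))
      ((integral\<^sup>L \<rho> G)\<^sup>2 + 4 * (\<integral>x. (G x)\<^sup>2 \<partial>\<rho>) + 2 * integral\<^sup>L \<rho> Q)"
    unfolding I4[symmetric] I3[symmetric] I22[symmetric]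
    by (intro has_bochner_integral_add has_bochner_integral_mult_right factorial_moment i3 i4 f2) auto
  then have ES2: "has_bochner_integral M (\<lambda>\<omega>. (S \<omega>)\<^sup>2)
      ((integral\<^sup>L \<rho> G)\<^sup>2 + 4 * (\<integral>x. (G x)\<^sup>2 \<partial>\<rho>) + 2 * integral\<^sup>L \<rho> Q)"
    unfolding S_def
    by (subst has_bochner_integral_cong[OF refl pair_sum_squared[OF finite_points sym diag] refl])
  show "integrable M S" and "integrable M (\<lambda>\<omega>. (S \<omega>)\<^sup>2)"
    using ES ES2 by (auto dest: integrable.intros)
  then have "variance S = (\<integral>\<omega>. (S \<omega>)\<^sup>2 \<partial>M) - (integral\<^sup>L M S)\<^sup>2" by (rule variance_eq)
  then show "variance S = 4 * (\<integral>x. (\<integral>y. f x y \<partial>\<rho>)\<^sup>2 \<partial>\<rho>) + 2 * (\<integral>x. (\<integral>y. (f x y)\<^sup>2 \<partial>\<rho>) \<partial>\<rho>)"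
    using has_bochner_integral_integral_eq[OF ES] has_bochner_integral_integral_eq[OF ES2]
    by (simp add: G_def[abs_def] Q_def[abs_def])
qed

end

section \<open>Radial integrals and the boundary layer\<close>

text \<open>Polar coordinates for radial functions. The two measures are compared on the rays
  \<open>{x<..}\<close>: on the left stands the volume of a shell, on the right the integral of the
  derivative of \<open>\<kappa> * s ^ d\<close>. Restricting to a ball keeps the masses
  finite.\<close>

lemma distr_norm_cball:
  fixes r :: real
  assumes r: "r > 0"
  defines "d \<equiv> DIM('a::euclidean_space)"
  defines "\<kappa> \<equiv> unit_ball_vol (real d)"
  shows "distr (density lborel (\<lambda>z::'a. indicator (cball 0 r) z)) borel norm =
    density lborel (\<lambda>s. ennreal (real d * \<kappa> * s ^ (d - 1)) * indicator {0..r} s)"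
    (is "?L = ?R")
proof (rule measure_eqI_lessThan)
  have d: "d > 0" by (simp add: d_def)
  have \<kappa>: "\<kappa> \<ge> 0" by (simp add: \<kappa>_def unit_ball_vol_nonneg)
  have [measurable]: "cball (0::'a) r \<in> sets borel" by (simp add: borel_closed)
  have L: "emeasure ?L {x<..} = emeasure lborel (cball (0::'a) r - cball 0 x)" for x
  proof -
    have "emeasure ?L {x<..} = emeasure (density lborel (\<lambda>z::'a. indicator (cball 0 r) z)) {z. x < norm z}"
      by (subst emeasure_distr) (auto simp: vimage_def)
    also have "\<dots> = (\<integral>\<^sup>+z. indicator (cball (0::'a) r) z * indicator {z. x < norm z} z \<partial>lborel)"
      by (subst emeasure_density) auto
    also have "\<dots> = (\<integral>\<^sup>+z. indicator (cball (0::'a) r - cball 0 x) z \<partial>lborel)"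
      by (intro nn_integral_cong) (auto simp: indicator_def)
    finally show ?thesis by simp
  qed
  show "emeasure ?L {x<..} < \<infinity>" for x
  proof -
    have "emeasure ?L {x<..} \<le> emeasure lborel (cball (0::'a) r)"
      unfolding L by (rule emeasure_mono) auto
    also have "\<dots> < \<infinity>" using r by (simp add: emeasure_cball)
    finally show ?thesis .
  qed
  show "emeasure ?L {x<..} = emeasure ?R {x<..}" for x
  proof -
    \<comment> \<open>\<open>x\<close> clamped to \<open>[0, r]\<close>. For \<open>x < 0\<close>
      the ball \<open>cball 0 x\<close> is empty while \<open>cball 0 y\<close> still contains the
      origin, hence the case distinction below.\<close>
    define y where "y = min r (max 0 x)"
    have y: "0 \<le> y" "y \<le> r" using r by (auto simp: y_def)
    have "cball (0::'a) r - cball 0 x = cball 0 r - (if x < 0 then {} else cball 0 y)"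
      by (auto simp: y_def)
    then have "emeasure ?L {x<..} = emeasure lborel (cball (0::'a) r - (if x < 0 then {} else cball 0 y))"
      by (simp only: L)
    also have "\<dots> = ennreal (\<kappa> * r ^ d) - ennreal (\<kappa> * y ^ d)"
    proof (cases "x < 0")
      case True
      then show ?thesis using r d by (simp add: emeasure_cball y_def d_def \<kappa>_def zero_power)
    next
      case False
      have "emeasure lborel (cball (0::'a) r - cball 0 y) = emeasure lborel (cball (0::'a) r) - emeasure lborel (cball (0::'a) y)"
        using y emeasure_lborel_cball_finite[of "0::'a" y] by (intro emeasure_Diff) auto
      then show ?thesis using False r y by (simp add: emeasure_cball d_def \<kappa>_def)
    qed
    also have "\<dots> = ennreal (\<kappa> * r ^ d - \<kappa> * y ^ d)"
      using y \<kappa> by (intro ennreal_minus) auto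
    also have "\<dots> = (\<integral>\<^sup>+s. ennreal (real d * \<kappa> * s ^ (d - 1)) * indicator {y..r} s \<partial>lborel)"
    proof (rule nn_integral_FTC_Icc[symmetric])
      show "DERIV (\<lambda>s. \<kappa> * s ^ d) s :> real d * \<kappa> * s ^ (d - 1)" for s
        by (auto intro!: derivative_eq_intros)
    qed (use y \<kappa> in auto)
    \<comment> \<open>The two domains of integration differ at most in the endpoints
      \<open>y\<close> and \<open>r\<close>.\<close>
    also have "\<dots> = (\<integral>\<^sup>+s. ennreal (real d * \<kappa> * s ^ (d - 1)) * indicator {0..r} s * indicator {x<..} s \<partial>lborel)"
      using AE_lborel_singleton[of y] AE_lborel_singleton[of r]
      by (intro nn_integral_cong_AE, eventually_elim) (auto simp: indicator_def y_def min_def max_def split: if_splits)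
    also have "\<dots> = emeasure ?R {x<..}" by (subst emeasure_density) auto
    finally show ?thesis .
  qed
qed auto

text \<open>As \<open>0 powr \<tau> = 0\<close>, the kernel vanishes at the origin for every
  \<open>\<tau>\<close>, which supplies the zero diagonal required in
  \<open>pair_sum_variance\<close>.\<close>

definition truncated_power :: "real \<Rightarrow> real \<Rightarrow> 'a::real_normed_vector \<Rightarrow> real" where
  "truncated_power \<tau> r z = (if norm z \<le> r then norm z powr \<tau> else 0)"

lemma borel_measurable_truncated_power [measurable]:
  "truncated_power \<tau> r \<in> borel_measurable (borel :: 'a::euclidean_space measure)"
  unfolding truncated_power_def[abs_def] by measurable

lemma truncated_power_nonneg [simp]: "0 \<le> truncated_power \<tau> r z"
  by (simp add: truncated_power_def)

lemma truncated_power_minus [simp]: "truncated_power \<tau> r (- z) = truncated_power \<tau> r z"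
  by (simp add: truncated_power_def)

lemma truncated_power_0 [simp]: "truncated_power \<tau> r 0 = 0"
  by (simp add: truncated_power_def)

lemma truncated_power_squared: "(truncated_power \<tau> r z)\<^sup>2 = truncated_power (2 * \<tau>) r z"
  by (simp add: truncated_power_def power2_eq_square powr_add[symmetric])

text \<open>For \<open>\<tau> > -d\<close> and \<open>r > 0\<close> this is the surface area of the
  unit sphere times the integral of \<open>s powr (\<tau> + d - 1)\<close> over
  \<open>[0, r]\<close>; the type argument carries the dimension.\<close>

definition truncated_power_mass :: "'a::euclidean_space itself \<Rightarrow> real \<Rightarrow> real \<Rightarrow> real" where
  "truncated_power_mass _ \<tau> r =
    real DIM('a) * unit_ball_vol (real DIM('a)) * r powr (\<tau> + real DIM('a)) / (\<tau> + real DIM('a))"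

lemma truncated_power_mass_nonneg: "\<tau> > - real DIM('a) \<Longrightarrow> 0 \<le> truncated_power_mass TYPE('a::euclidean_space) \<tau> r"
  by (simp add: truncated_power_mass_def unit_ball_vol_nonneg)

lemma nn_integral_truncated_power:
  fixes \<tau> r :: real
  assumes r: "r > 0" and \<tau>: "\<tau> > - real DIM('a)"
  shows "(\<integral>\<^sup>+z. ennreal (truncated_power \<tau> r (z::'a::euclidean_space)) \<partial>lborel) =
    ennreal (truncated_power_mass TYPE('a) \<tau> r)"
proof -
  define d where "d = DIM('a)"
  define \<kappa> where "\<kappa> = unit_ball_vol (real d)"
  have d: "d > 0" by (simp add: d_def)
  have \<kappa>: "\<kappa> \<ge> 0" by (simp add: \<kappa>_def unit_ball_vol_nonneg)
  have [measurable]: "cball (0::'a) r \<in> sets borel" by (simp add: borel_closed)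
  have "(\<integral>\<^sup>+z. ennreal (truncated_power \<tau> r (z::'a)) \<partial>lborel) =
      (\<integral>\<^sup>+z. indicator (cball (0::'a) r) z * ennreal (norm z powr \<tau>) \<partial>lborel)"
    by (intro nn_integral_cong) (auto simp: truncated_power_def indicator_def)
  also have "\<dots> = (\<integral>\<^sup>+s. ennreal (s powr \<tau>) \<partial>distr (density lborel (\<lambda>z::'a. indicator (cball 0 r) z)) borel norm)"
    by (subst nn_integral_distr) (auto simp: nn_integral_density)
  also have "\<dots> = (\<integral>\<^sup>+s. ennreal (real d * \<kappa> * s ^ (d - 1)) * indicator {0..r} s * ennreal (s powr \<tau>) \<partial>lborel)"
    unfolding distr_norm_cball[OF r, where 'a = 'a, folded d_def, folded \<kappa>_def]
    by (subst nn_integral_density) auto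
  also have "\<dots> = (\<integral>\<^sup>+s. ennreal (real d * \<kappa> * (if s \<in> {0..r} then s powr (\<tau> + real d - 1) else 0)) \<partial>lborel)"
  proof (intro nn_integral_cong)
    fix s :: real
    \<comment> \<open>The point \<open>s = 0\<close> is separate: there both sides are 0 by the
      convention for \<open>powr\<close>, although \<open>s ^ (d - 1)\<close> is 1 when
      \<open>d = 1\<close>.\<close>
    have "s ^ (d - 1) * s powr \<tau> = s powr (\<tau> + real d - 1)" if "s \<ge> 0"
    proof (cases "s = 0")
      case False
      then have "s ^ (d - 1) = s powr real (d - 1)" using that by (simp add: powr_realpow)
      then show ?thesis using d by (simp add: powr_add[symmetric] of_nat_diff algebra_simps)
    qed simp
    then show "ennreal (real d * \<kappa> * s ^ (d - 1)) * indicator {0..r} s * ennreal (s powr \<tau>) =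
        ennreal (real d * \<kappa> * (if s \<in> {0..r} then s powr (\<tau> + real d - 1) else 0))"
      using \<kappa> by (auto simp: indicator_def ennreal_mult[symmetric] mult.assoc)
  qed
  also have "\<dots> = ennreal (real d * \<kappa> * (r powr (\<tau> + real d - 1 + 1) / (\<tau> + real d - 1 + 1)))"
  proof (rule nn_integral_has_integral_lborel)
    have "((\<lambda>s. s powr (\<tau> + real d - 1)) has_integral (r powr (\<tau> + real d - 1 + 1) / (\<tau> + real d - 1 + 1))) {0..r}"
      using r \<tau> by (intro has_integral_powr_from_0) (auto simp: d_def)
    then show "((\<lambda>s. real d * \<kappa> * (if s \<in> {0..r} then s powr (\<tau> + real d - 1) else 0)) has_integral
        (real d * \<kappa> * (r powr (\<tau> + real d - 1 + 1) / (\<tau> + real d - 1 + 1)))) UNIV"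
      by (intro has_integral_mult_right) (simp only: has_integral_restrict_UNIV)
  qed (use \<kappa> in auto)
  finally show ?thesis by (simp add: truncated_power_mass_def d_def \<kappa>_def)
qed

lemma lborel_reflect: "distr lborel borel (\<lambda>y. x - y) = (lborel :: 'a::euclidean_space measure)"
  using lborel_affine[of "-1" x] by (simp add: density_1 flip: one_ennreal_def)

lemma has_bochner_integral_truncated_power:
  fixes x :: "'a::euclidean_space"
  assumes "r > 0" and "\<tau> > - real DIM('a)"
  shows "has_bochner_integral lborel (\<lambda>y. truncated_power \<tau> r (x - y)) (truncated_power_mass TYPE('a) \<tau> r)"
proof (rule has_bochner_integral_nn_integral)
  have "(\<integral>\<^sup>+y. ennreal (truncated_power \<tau> r (x - y)) \<partial>lborel) =
      (\<integral>\<^sup>+y. ennreal (truncated_power \<tau> r y) \<partial>distr lborel borel (\<lambda>y. x - y))"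
    by (subst nn_integral_distr) auto
  then show "(\<integral>\<^sup>+y. ennreal (truncated_power \<tau> r (x - y)) \<partial>lborel) = ennreal (truncated_power_mass TYPE('a) \<tau> r)"
    using nn_integral_truncated_power[OF assms] by (simp add: lborel_reflect)
qed (use assms truncated_power_mass_nonneg in auto)

section \<open>The boundary layer of a compact convex set\<close>

definition boundary_layer :: "'a::euclidean_space set \<Rightarrow> real \<Rightarrow> 'a set" where
  "boundary_layer W r = {x \<in> W. infdist x (- W) \<le> r}"

lemma boundary_layer_sets [measurable]: "compact W \<Longrightarrow> boundary_layer W r \<in> sets borel"
proof -
  assume W: "compact W"
  have "boundary_layer W r = W \<inter> {x. infdist x (- W) \<le> r}"
    by (auto simp: boundary_layer_def)
  also have "closed \<dots>"
    using W by (intro closed_Int compact_imp_closed closed_Collect_le continuous_intros) auto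
  then have "(W \<inter> {x. infdist x (- W) \<le> r}) \<in> sets borel" by (rule borel_closed)
  finally show ?thesis .
qed

text \<open>The layer is defined by the distance to the complement, with \<open>\<le>\<close>, so a
  point of \<open>W\<close> off it has distance more than \<open>r\<close> from every point outside
  \<open>W\<close>. This is why the closed ball fits.\<close>

lemma cball_subset_off_boundary_layer:
  assumes "x \<in> W" "x \<notin> boundary_layer W r"
  shows "cball x r \<subseteq> W"
proof
  fix y assume y: "y \<in> cball x r"
  show "y \<in> W"
  proof (rule ccontr)
    assume "y \<notin> W"
    then have "infdist x (- W) \<le> r" using y by (intro infdist_le2[of y]) auto
    then show False using assms by (auto simp: boundary_layer_def)
  qed
qed

text \<open>Dominated convergence with majorant \<open>indicator W\<close>: an interior point leaves
  the layer once \<open>\<delta> t\<close> is below its distance to the complement, and the frontier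
  of a convex set is negligible.\<close>

lemma boundary_layer_tendsto_0:
  fixes W :: "'a::euclidean_space set" and \<delta> :: "real \<Rightarrow> real"
  assumes W: "convex W" "compact W" and \<delta>: "(\<delta> \<longlongrightarrow> (0::real)) at_top"
  shows "((\<lambda>t. measure lborel (boundary_layer W (\<delta> t))) \<longlongrightarrow> 0) at_top"
proof -
  \<comment> \<open>\<open>infdist\<close> to the empty set is 0 by default, so the complement must
    be seen to be nonempty.\<close>
  have ne: "- W \<noteq> {}" using compact_imp_bounded[OF W(2)] not_bounded_UNIV[where 'a = 'a] by (metis Compl_empty_eq double_complement)
  have fW: "emeasure lborel W < \<infinity>" using emeasure_compact_finite[OF W(2)] .
  have WB: "W \<in> sets borel" using W(2) by (simp add: borel_compact)
  have "frontier W \<in> null_sets lebesgue"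
    using negligible_convex_frontier[OF W(1)] by (simp add: negligible_iff_null_sets)
  moreover have "frontier W \<in> sets lborel" by (simp add: borel_closed)
  ultimately have nullf: "AE x in lborel. x \<notin> frontier W"
    by (intro AE_not_in) (simp add: null_sets_completion_iff)
  have "((\<lambda>t. \<integral>x. indicator (boundary_layer W (\<delta> t)) x \<partial>lborel) \<longlongrightarrow> integral\<^sup>L lborel (\<lambda>_::'a. 0::real)) at_top"
  proof (rule integral_dominated_convergence_at_top)
    show "integrable lborel (indicator W :: 'a \<Rightarrow> real)" using fW WB by (simp add: integrable_indicator_iff)
    show "\<And>t. (indicator (boundary_layer W (\<delta> t)) :: 'a \<Rightarrow> real) \<in> borel_measurable lborel"
      using W(2) by measurable
    show "\<forall>\<^sub>F i in at_top. AE x in lborel. norm (indicator (boundary_layer W (\<delta> i)) x :: real) \<le> indicator W x"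
      by (auto simp: boundary_layer_def indicator_def)
    show "AE x in lborel. ((\<lambda>t. indicator (boundary_layer W (\<delta> t)) x) \<longlongrightarrow> (0::real)) at_top"
      using nullf
    proof eventually_elim
      case (elim x)
      show ?case
      proof (cases "x \<in> W")
        case False
        then show ?thesis by (simp add: boundary_layer_def)
      next
        case True
        then have "x \<in> interior W"
          using elim closure_subset by (auto simp: frontier_def)
        then have "x \<notin> closure (- W)" by (simp add: closure_complement)
        then have "infdist x (- W) > 0"
          using in_closure_iff_infdist_zero[OF ne, of x] infdist_nonneg[of x "- W"] by linarith
        then have "\<forall>\<^sub>F t in at_top. \<delta> t < infdist x (- W)"
          using order_tendstoD(2)[OF \<delta>] by blast
        then show ?thesis
          by (intro tendsto_eventually) (auto elim!: eventually_mono simp: boundary_layer_def)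
      qed
    qed
  qed simp
  then show ?thesis using W(2) by simp
qed

section \<open>Length power functionals\<close>

text \<open>A measure on the whole space with density 0 off \<open>W\<close>, so that its
  \<sigma>-algebra stays \<open>borel\<close> and \<open>W\<close> enters only through
  integrals.\<close>

definition poisson_intensity :: "real \<Rightarrow> 'a::euclidean_space set \<Rightarrow> 'a measure" where
  "poisson_intensity t W = density lborel (\<lambda>x. ennreal (t * indicator W x))"

lemma sets_poisson_intensity [simp, measurable_cong]: "sets (poisson_intensity t W) = sets borel"
  by (simp add: poisson_intensity_def)

lemma emeasure_poisson_intensity:
  assumes W: "compact W" and t: "t > 0" and A: "A \<in> sets borel"
  shows "emeasure (poisson_intensity t W) A = ennreal (t * measure lborel (A \<inter> W))"
proof -
  have [measurable]: "W \<in> sets borel" "A \<in> sets borel" using W A by (auto simp: borel_compact)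
  have fin: "emeasure lborel (A \<inter> W) < \<infinity>"
  proof -
    have "emeasure lborel (A \<inter> W) \<le> emeasure lborel W" by (rule emeasure_mono) auto
    also have "\<dots> < \<infinity>" by (rule emeasure_compact_finite[OF W])
    finally show ?thesis .
  qed
  have "emeasure (poisson_intensity t W) A = (\<integral>\<^sup>+x. ennreal (t * indicator W x) * indicator A x \<partial>lborel)"
    unfolding poisson_intensity_def by (subst emeasure_density) auto
  also have "\<dots> = (\<integral>\<^sup>+x. ennreal t * indicator (A \<inter> W) x \<partial>lborel)"
    by (intro nn_integral_cong) (auto simp: indicator_def)
  also have "\<dots> = ennreal t * emeasure lborel (A \<inter> W)"
    by (simp add: nn_integral_cmult_indicator)
  also have "\<dots> = ennreal (t * measure lborel (A \<inter> W))"
    using fin t by (simp add: emeasure_eq_ennreal_measure ennreal_mult)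
  finally show ?thesis .
qed

lemma integral_poisson_intensity:
  fixes f :: "'a::euclidean_space \<Rightarrow> real"
  assumes W: "compact W" and t: "t > 0" and f: "f \<in> borel_measurable borel"
  shows "integral\<^sup>L (poisson_intensity t W) f = t * (\<integral>x. indicator W x * f x \<partial>lborel)"
proof -
  have [measurable]: "W \<in> sets borel" using W by (simp add: borel_compact)
  have "integral\<^sup>L (poisson_intensity t W) f = (\<integral>x. (t * indicator W x) *\<^sub>R f x \<partial>lborel)"
    unfolding poisson_intensity_def using f t by (subst integral_density) (auto simp: indicator_def)
  then show ?thesis by (simp add: mult.assoc)
qed

lemma poisson_process_of_poisson_pp:
  assumes pp: "poisson_pp M N W t" and t: "t > 0" and W: "compact W"
  shows "poisson_process M N (poisson_intensity t W)"
proof -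
  note em = emeasure_poisson_intensity[OF W t]
  have m: "measure (poisson_intensity t W) A = t * measure lborel (A \<inter> W)" if "A \<in> sets borel" for A
    using em[OF that] t by (simp add: measure_def)
  interpret prob_space M using pp by (simp add: poisson_pp_def)
  show ?thesis
  proof (intro poisson_process.intro poisson_process_axioms.intro)
    show "prob_space M" by unfold_locales
    have "space (poisson_intensity t W) = UNIV" by (simp add: poisson_intensity_def)
    then show "finite_measure (poisson_intensity t W)"
      by (intro finite_measureI) (simp add: em)
    show "emeasure (poisson_intensity t W) {x} = 0" for x
    proof -
      have "measure lborel ({x} \<inter> W) = 0" by (cases "x \<in> W") auto
      then show ?thesis by (simp add: em)
    qed
  qed (use pp in \<open>auto simp: poisson_pp_def m\<close>)
qed

lemma length_power_eq_sum_distinct_tuples: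
  assumes "finite X"
  shows "length_power \<tau> r X = (\<Sum>x\<in>distinct_tuples 2 X. truncated_power \<tau> r (x 0 - x 1) / 2)"
proof -
  have "{(x1, x2). x1 \<in> X \<and> x2 \<in> X \<and> x1 \<noteq> x2} = (SIGMA a:X. X - {a})" by auto
  then have "length_power \<tau> r X = 1/2 * (\<Sum>a\<in>X. \<Sum>b\<in>X - {a}. truncated_power \<tau> r (a - b))"
    using assms by (simp add: length_power_def sum.Sigma truncated_power_def case_prod_unfold)
  also have "\<dots> = (\<Sum>a\<in>X. \<Sum>b\<in>X - {a}. truncated_power \<tau> r (a - b) / 2)"
    by (simp add: sum_divide_distrib)
  finally show ?thesis
    using sum_distinct_tuples_2[OF assms, of "\<lambda>a b. truncated_power \<tau> r (a - b) / 2"] by simp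
qed

text \<open>The inner integral over \<open>W\<close> is at most \<open>t\<close> times the one over
  the whole space, which is the same for all \<open>x\<close>; the outer measure is finite.\<close>

lemma integrable_truncated_power_pair:
  fixes W :: "'a::euclidean_space set"
  assumes W: "compact W" and t: "t > 0" and r: "r > 0" and \<tau>: "\<tau> > - real DIM('a)"
  shows "integrable (poisson_intensity t W \<Otimes>\<^sub>M poisson_intensity t W) (\<lambda>(x, y). truncated_power \<tau> r (x - y))"
proof -
  let ?\<rho> = "poisson_intensity t W"
  have [measurable]: "W \<in> sets borel" using W by (simp add: borel_compact)
  have fin: "finite_measure ?\<rho>"
    by (intro finite_measureI) (simp add: emeasure_poisson_intensity[OF W t] poisson_intensity_def[THEN arg_cong, of space])
  then interpret finite_measure ?\<rho> .
  have m: "(\<lambda>(x, y). truncated_power \<tau> r (x - y)) \<in> borel_measurable (?\<rho> \<Otimes>\<^sub>M ?\<rho>)"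
    by measurable
  have inner: "(\<integral>\<^sup>+y. ennreal (truncated_power \<tau> r (x - y)) \<partial>?\<rho>) \<le> ennreal (t * truncated_power_mass TYPE('a) \<tau> r)" for x
  proof -
    have "(\<integral>\<^sup>+y. ennreal (truncated_power \<tau> r (x - y)) \<partial>?\<rho>) =
        (\<integral>\<^sup>+y. ennreal (t * indicator W y) * ennreal (truncated_power \<tau> r (x - y)) \<partial>lborel)"
      unfolding poisson_intensity_def by (subst nn_integral_density) auto
    also have "\<dots> \<le> (\<integral>\<^sup>+y. ennreal t * ennreal (truncated_power \<tau> r (x - y)) \<partial>lborel)"
      using t by (intro nn_integral_mono) (auto simp: indicator_def)
    also have "\<dots> = ennreal t * ennreal (truncated_power_mass TYPE('a) \<tau> r)"
      using has_bochner_integral_truncated_power[OF r \<tau>, of x]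
      by (subst nn_integral_cmult)
        (auto simp: nn_integral_eq_integral has_bochner_integral_iff)
    finally show ?thesis using t by (simp add: ennreal_mult truncated_power_mass_nonneg[OF \<tau>])
  qed
  have "(\<integral>\<^sup>+p. ennreal (norm (case p of (x, y) \<Rightarrow> truncated_power \<tau> r (x - y))) \<partial>(?\<rho> \<Otimes>\<^sub>M ?\<rho>)) =
      (\<integral>\<^sup>+x. \<integral>\<^sup>+y. ennreal (truncated_power \<tau> r (x - y)) \<partial>?\<rho> \<partial>?\<rho>)"
    by (subst nn_integral_fst[symmetric]) auto
  also have "\<dots> \<le> (\<integral>\<^sup>+x. ennreal (t * truncated_power_mass TYPE('a) \<tau> r) \<partial>?\<rho>)"
    by (intro nn_integral_mono inner)
  also have "\<dots> < \<infinity>"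
    by (simp add: emeasure_eq_measure ennreal_mult_less_top)
  finally show ?thesis using m by (simp add: integrable_iff_bounded)
qed

section \<open>Normalisation and the deviation bound\<close>

lemma normalized_length_power_eq:
  fixes N :: "'w \<Rightarrow> 'a::euclidean_space set"
  assumes r: "r > 0" and t: "t > 0" and dense: "t * r ^ DIM('a) \<ge> 1"
  shows "normalized_length_power M N t r \<tau> \<omega> =
    (length_power \<tau> r (N \<omega>) - (\<integral>\<omega>'. length_power \<tau> r (N \<omega>') \<partial>M)) / (t powr (3/2) * r powr (\<tau> + real DIM('a)))"
proof -
  \<comment> \<open>The right side is the ratio of the second to the first candidate in the maximum,
    so the dense regime selects the second.\<close>
  have "1 \<le> (t * r ^ DIM('a)) powr (1/2)" using dense by (intro ge_one_powr_ge_zero) auto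
  also have "\<dots> = t powr (1/2) * r powr (real DIM('a) / 2)"
    using r t by (simp add: powr_mult powr_realpow[symmetric] powr_powr)
  finally have "t * r powr (\<tau> + real DIM('a) / 2) * 1 \<le>
      t * r powr (\<tau> + real DIM('a) / 2) * (t powr (1/2) * r powr (real DIM('a) / 2))"
    using t by (intro mult_left_mono) auto
  also have "\<dots> = (t powr 1 * t powr (1/2)) * (r powr (\<tau> + real DIM('a) / 2) * r powr (real DIM('a) / 2))"
    using t by simp
  also have "\<dots> = t powr (3/2) * r powr (\<tau> + real DIM('a))"
    by (simp only: powr_add[symmetric]) (simp add: add.assoc)
  finally show ?thesis by (simp add: normalized_length_power_def max_def)
qed

lemma difference_squared_le:
  fixes u v :: real
  shows "((u - v) / 2)\<^sup>2 \<le> (u\<^sup>2 + v\<^sup>2) / 2"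
proof -
  have "0 \<le> (u + v)\<^sup>2" by simp
  then show ?thesis by (simp add: power2_eq_square field_simps)
qed

text \<open>The non-asymptotic form of the result. \<open>D\<close> is the surface area of the unit
  sphere, and \<open>C\<close> collects the masses of the squared kernels; the bounds on
  \<open>\<tau>1\<close> and \<open>\<tau>2\<close> keep its denominators positive. The two summands
  bound the two parts of the variance divided by \<open>t ^ 3\<close>.\<close>

lemma normalized_length_power_deviation:
  fixes M :: "'w measure" and N :: "'w \<Rightarrow> 'a::euclidean_space set" and W :: "'a set"
    and t r \<tau>1 \<tau>2 e :: real
  assumes W: "compact W" and pp: "poisson_pp M N W t"
    and t: "t > 0" and r: "r > 0" and dense: "t * r ^ DIM('a) \<ge> 1"
    and \<tau>: "\<tau>1 > - real DIM('a) / 2" "\<tau>2 > - real DIM('a) / 2" and e: "e > 0"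
  defines "D \<equiv> real DIM('a) * unit_ball_vol (real DIM('a))"
  defines "a1 \<equiv> \<tau>1 + real DIM('a)" and "a2 \<equiv> \<tau>2 + real DIM('a)"
  defines "C \<equiv> D * (a1\<^sup>2 / (2 * \<tau>1 + real DIM('a)) + a2\<^sup>2 / (2 * \<tau>2 + real DIM('a))) / 2"
  shows "measure M {\<omega> \<in> space M. \<bar>a1 * normalized_length_power M N t r \<tau>1 \<omega>
      - a2 * normalized_length_power M N t r \<tau>2 \<omega>\<bar> > e} \<le>
    (4 * D\<^sup>2 * measure lborel (boundary_layer W r) +
      2 * measure lborel W * C / (t * r ^ DIM('a))) / e\<^sup>2"
proof -
  define d where "d = real DIM('a)"
  define \<rho> where "\<rho> = poisson_intensity t W"
  interpret poisson_process M N \<rho>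
    unfolding \<rho>_def by (rule poisson_process_of_poisson_pp[OF pp t W])
  have d: "d > 0" by (simp add: d_def)
  have D: "D \<ge> 0" by (simp add: D_def unit_ball_vol_nonneg)
  have a: "a1 > 0" "a2 > 0" using \<tau> d unfolding a1_def a2_def d_def by linarith+
  have [measurable]: "W \<in> sets borel" using W by (simp add: borel_compact)
  have fW: "emeasure lborel W < \<infinity>" by (rule emeasure_compact_finite[OF W])
  have \<tau>d: "\<tau>1 > - real DIM('a)" "\<tau>2 > - real DIM('a)" "2 * \<tau>1 > - real DIM('a)" "2 * \<tau>2 > - real DIM('a)"
    using \<tau> d unfolding d_def by linarith+
  \<comment> \<open>\<open>c1\<close> and \<open>c2\<close> absorb the weights and the powers of
    \<open>r\<close> from the normalisation; what remains is the common divisor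
    \<open>t powr (3/2)\<close>.\<close>
  define c1 where "c1 = a1 * r powr (- a1)"
  define c2 where "c2 = a2 * r powr (- a2)"
  have c: "c1 > 0" "c2 > 0" using a r by (auto simp: c1_def c2_def)
  let ?m = "truncated_power_mass TYPE('a)"
  have cm: "c1 * ?m \<tau>1 r = D" "c2 * ?m \<tau>2 r = D"
    unfolding c1_def c2_def truncated_power_mass_def D_def[symmetric] a1_def[symmetric] a2_def[symmetric]
    using a r by (auto simp: powr_minus field_simps)
  \<comment> \<open>The exponents add up to \<open>- 2 * a + 2 * \<tau> + d = - d\<close>,
    independently of \<open>\<tau>\<close>; hence the common factor
    \<open>1 / r ^ d\<close>.\<close>
  have cm2_aux: "(a * r powr (- a))\<^sup>2 * ?m (2 * \<tau>) r = D * (a\<^sup>2 / (2 * \<tau> + d)) / r ^ DIM('a)"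
    if "a = \<tau> + d" for a \<tau>
  proof -
    have "(r powr (- a))\<^sup>2 * r powr (2 * \<tau> + d) = r powr (- d)"
      by (simp add: power2_eq_square powr_add[symmetric] that)
    also have "\<dots> = 1 / r ^ DIM('a)"
      using r by (simp add: powr_minus powr_realpow d_def divide_inverse)
    finally have "a\<^sup>2 * (D / (2 * \<tau> + d)) * ((r powr (- a))\<^sup>2 * r powr (2 * \<tau> + d)) =
      a\<^sup>2 * (D / (2 * \<tau> + d)) * (1 / r ^ DIM('a))" by simp
    then show ?thesis
      by (simp add: truncated_power_mass_def D_def d_def power_mult_distrib mult_ac)
  qed
  have cm2: "(c1\<^sup>2 * ?m (2 * \<tau>1) r + c2\<^sup>2 * ?m (2 * \<tau>2) r) / 2 = C / r ^ DIM('a)"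
  proof -
    have "(D * u / R + D * v / R) / 2 = D * (u + v) / 2 / R" for u v R
      by (cases "R = 0") (simp_all add: field_simps)
    moreover have "c1\<^sup>2 * ?m (2 * \<tau>1) r = D * (a1\<^sup>2 / (2 * \<tau>1 + d)) / r ^ DIM('a)"
      unfolding c1_def by (rule cm2_aux) (simp add: a1_def d_def)
    moreover have "c2\<^sup>2 * ?m (2 * \<tau>2) r = D * (a2\<^sup>2 / (2 * \<tau>2 + d)) / r ^ DIM('a)"
      unfolding c2_def by (rule cm2_aux) (simp add: a2_def d_def)
    ultimately show ?thesis by (simp only: C_def d_def)
  qed
  define g where "g \<tau> x y = truncated_power \<tau> r (x - y) / 2" for \<tau> and x y :: 'a
  have g_sym: "g \<tau> x y = g \<tau> y x" for \<tau> x y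
    using truncated_power_minus[of \<tau> r "x - y"] by (simp add: g_def)
  have g_diag: "g \<tau> x x = 0" for \<tau> x by (simp add: g_def)
  have g_meas [measurable]: "(\<lambda>(x, y). g \<tau> x y) \<in> borel_measurable (\<rho> \<Otimes>\<^sub>M \<rho>)" for \<tau>
    unfolding g_def by measurable
  have g_meas' [measurable]: "g \<tau> x \<in> borel_measurable borel" for \<tau> x
    unfolding g_def[abs_def] by measurable
  have g_sq: "(g \<tau> x y)\<^sup>2 = truncated_power (2 * \<tau>) r (x - y) / 4" for \<tau> x y
    by (simp add: g_def power_divide truncated_power_squared)
  have g_int2: "integrable (\<rho> \<Otimes>\<^sub>M \<rho>) (\<lambda>(x, y). (g \<tau> x y)\<^sup>2)" if "2 * \<tau> > - real DIM('a)" for \<tau>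
    using integrable_divide[OF integrable_truncated_power_pair[OF W t r that], of 4]
    by (simp add: g_sq \<rho>_def case_prod_unfold)
  have g_int: "has_bochner_integral lborel (g \<tau> x) (?m \<tau> r / 2)" if "\<tau> > - real DIM('a)" for \<tau> x
    using has_bochner_integral_divide[OF has_bochner_integral_truncated_power[OF r that, of x], of 2]
    by (simp add: g_def[abs_def])
  define f where "f x y = c1 * g \<tau>1 x y - c2 * g \<tau>2 x y" for x y
  have f_meas [measurable]: "(\<lambda>(x, y). f x y) \<in> borel_measurable (\<rho> \<Otimes>\<^sub>M \<rho>)"
    unfolding f_def by measurable
  have f_meas' [measurable]: "f x \<in> borel_measurable borel" for x
    unfolding f_def[abs_def] by measurable
  \<comment> \<open>The cancellation behind the result: the two halved kernels both have mass
    \<open>D / 2\<close>.\<close>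
  have f_int: "has_bochner_integral lborel (f x) 0" for x
  proof -
    have "has_bochner_integral lborel (f x) (c1 * (?m \<tau>1 r / 2) - c2 * (?m \<tau>2 r / 2))"
      unfolding f_def[abs_def]
      by (intro has_bochner_integral_diff has_bochner_integral_mult_right g_int \<tau>d)
    then show ?thesis using cm by simp
  qed
  \<comment> \<open>Where \<open>W\<close> cuts the ball the cancellation fails, but the triangle
    inequality still gives \<open>D / 2 + D / 2\<close>.\<close>
  have f_abs: "(\<integral>y. \<bar>f x y\<bar> \<partial>lborel) \<le> D" for x
  proof -
    have gi: "has_bochner_integral lborel (\<lambda>y. c1 * g \<tau>1 x y + c2 * g \<tau>2 x y) (c1 * (?m \<tau>1 r / 2) + c2 * (?m \<tau>2 r / 2))"
      by (intro has_bochner_integral_add has_bochner_integral_mult_right g_int \<tau>d)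
    have "(\<integral>y. \<bar>f x y\<bar> \<partial>lborel) \<le> (\<integral>y. c1 * g \<tau>1 x y + c2 * g \<tau>2 x y \<partial>lborel)"
    proof (rule integral_mono')
      show "integrable lborel (\<lambda>y. c1 * g \<tau>1 x y + c2 * g \<tau>2 x y)" using gi by (auto dest: integrable.intros)
      have nn: "0 \<le> c1 * g \<tau>1 x y" "0 \<le> c2 * g \<tau>2 x y" for y using c by (auto simp: g_def)
      show "\<bar>f x y\<bar> \<le> c1 * g \<tau>1 x y + c2 * g \<tau>2 x y" "0 \<le> c1 * g \<tau>1 x y + c2 * g \<tau>2 x y" for y
        using nn[of y] unfolding f_def by linarith+
    qed
    also have "\<dots> = D" using has_bochner_integral_integral_eq[OF gi] cm by simp
    finally show ?thesis .
  qed
  have f_sq_le: "(f x y)\<^sup>2 \<le> 2 * (c1\<^sup>2 * (g \<tau>1 x y)\<^sup>2 + c2\<^sup>2 * (g \<tau>2 x y)\<^sup>2)" for x y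
    using difference_squared_le[of "c1 * g \<tau>1 x y" "c2 * g \<tau>2 x y"]
    by (simp add: f_def power_divide power_mult_distrib)
  have f_sq: "integrable (\<rho> \<Otimes>\<^sub>M \<rho>) (\<lambda>(x, y). (f x y)\<^sup>2)"
  proof (rule Bochner_Integration.integrable_bound)
    show "integrable (\<rho> \<Otimes>\<^sub>M \<rho>) (\<lambda>p. 2 * (c1\<^sup>2 * (case p of (x, y) \<Rightarrow> (g \<tau>1 x y)\<^sup>2)
        + c2\<^sup>2 * (case p of (x, y) \<Rightarrow> (g \<tau>2 x y)\<^sup>2)))"
      by (intro integrable_mult_right Bochner_Integration.integrable_add g_int2 \<tau>d)
    show "AE p in \<rho> \<Otimes>\<^sub>M \<rho>. norm (case p of (x, y) \<Rightarrow> (f x y)\<^sup>2) \<le>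
        norm (2 * (c1\<^sup>2 * (case p of (x, y) \<Rightarrow> (g \<tau>1 x y)\<^sup>2) + c2\<^sup>2 * (case p of (x, y) \<Rightarrow> (g \<tau>2 x y)\<^sup>2)))"
      using f_sq_le by (auto simp: case_prod_unfold)
  qed measurable
  have f_sq_int: "(\<integral>y. indicator W y * (f x y)\<^sup>2 \<partial>lborel) \<le> C / r ^ DIM('a)" for x
  proof -
    have gi: "has_bochner_integral lborel (\<lambda>y. (c1\<^sup>2 * truncated_power (2 * \<tau>1) r (x - y) + c2\<^sup>2 * truncated_power (2 * \<tau>2) r (x - y)) / 2)
       ((c1\<^sup>2 * ?m (2 * \<tau>1) r + c2\<^sup>2 * ?m (2 * \<tau>2) r) / 2)"
      by (intro has_bochner_integral_divide has_bochner_integral_add has_bochner_integral_mult_right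
          has_bochner_integral_truncated_power r \<tau>d)
    have "(\<integral>y. indicator W y * (f x y)\<^sup>2 \<partial>lborel) \<le>
        (\<integral>y. (c1\<^sup>2 * truncated_power (2 * \<tau>1) r (x - y) + c2\<^sup>2 * truncated_power (2 * \<tau>2) r (x - y)) / 2 \<partial>lborel)"
    proof (rule integral_mono')
      fix y
      show "0 \<le> (c1\<^sup>2 * truncated_power (2 * \<tau>1) r (x - y) + c2\<^sup>2 * truncated_power (2 * \<tau>2) r (x - y)) / 2" by simp
      moreover have "(f x y)\<^sup>2 \<le> (c1\<^sup>2 * truncated_power (2 * \<tau>1) r (x - y) + c2\<^sup>2 * truncated_power (2 * \<tau>2) r (x - y)) / 2"
        using f_sq_le[of x y] by (simp add: g_sq)
      ultimately show "indicator W y * (f x y)\<^sup>2 \<le>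
          (c1\<^sup>2 * truncated_power (2 * \<tau>1) r (x - y) + c2\<^sup>2 * truncated_power (2 * \<tau>2) r (x - y)) / 2"
        by (simp add: indicator_def)
    qed (use gi in \<open>auto dest: integrable.intros\<close>)
    also have "\<dots> = C / r ^ DIM('a)" using has_bochner_integral_integral_eq[OF gi] cm2 by simp
    finally show ?thesis .
  qed
  define S where "S \<omega> = (\<Sum>x\<in>distinct_tuples 2 (N \<omega>). f (x 0) (x 1))" for \<omega>
  have f_sym: "f x y = f y x" for x y using g_sym[of _ x y] by (simp add: f_def)
  have f_diag: "f x x = 0" for x by (simp add: f_def g_diag)
  note S_int = pair_sum_variance(1)[OF f_meas f_sym f_diag f_sq, folded S_def]
    and S_sq_int = pair_sum_variance(2)[OF f_meas f_sym f_diag f_sq, folded S_def]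
    and S_var = pair_sum_variance(3)[OF f_meas f_sym f_diag f_sq, folded S_def]
  have first: "(\<integral>x. (\<integral>y. f x y \<partial>\<rho>)\<^sup>2 \<partial>\<rho>) \<le> t ^ 3 * D\<^sup>2 * measure lborel (boundary_layer W r)"
  proof -
    define G where "G x = (\<integral>y. f x y \<partial>\<rho>)" for x
    have G: "G x = t * (\<integral>y. indicator W y * f x y \<partial>lborel)" for x
      unfolding G_def \<rho>_def by (rule integral_poisson_intensity[OF W t f_meas'])
    have G_meas [measurable]: "G \<in> borel_measurable borel"
    proof -
      have "G \<in> borel_measurable \<rho>" unfolding G_def by measurable
      then show ?thesis by simp
    qed
    have G_bound: "\<bar>G x\<bar> \<le> t * D" for x
    proof -
      have "\<bar>\<integral>y. indicator W y * f x y \<partial>lborel\<bar> \<le> (\<integral>y. \<bar>f x y\<bar> \<partial>lborel)"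
      proof -
        have "\<bar>\<integral>y. indicator W y * f x y \<partial>lborel\<bar> \<le> (\<integral>y. \<bar>indicator W y * f x y\<bar> \<partial>lborel)"
          by (rule integral_abs_bound)
        also have "\<dots> \<le> (\<integral>y. \<bar>f x y\<bar> \<partial>lborel)"
          using f_int[of x] by (intro integral_mono') (auto simp: indicator_def dest: integrable.intros)
        finally show ?thesis .
      qed
      then show ?thesis using f_abs[of x] t by (simp add: G abs_mult)
    qed
    \<comment> \<open>If the ball lies in \<open>W\<close>, the restriction to \<open>W\<close> does
      not touch the support of \<open>f x\<close>, and the integral over the whole space is
      0.\<close>
    have G_zero: "G x = 0" if "cball x r \<subseteq> W" for x
    proof -
      have "indicator W y * f x y = f x y" for y
      proof (cases "y \<in> W")
        case False
        then have "y \<notin> cball x r" using that by auto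
        then have "f x y = 0" by (simp add: f_def g_def truncated_power_def dist_norm)
        then show ?thesis by simp
      qed simp
      then have "(\<lambda>y. indicator W y * f x y) = f x" by (rule ext)
      then show ?thesis using has_bochner_integral_integral_eq[OF f_int[of x]] by (simp only: G mult_zero_right)
    qed
    have "(\<integral>x. (G x)\<^sup>2 \<partial>\<rho>) = t * (\<integral>x. indicator W x * (G x)\<^sup>2 \<partial>lborel)"
      unfolding \<rho>_def by (rule integral_poisson_intensity[OF W t]) measurable
    also have "(\<integral>x. indicator W x * (G x)\<^sup>2 \<partial>lborel) \<le> (\<integral>x. (t * D)\<^sup>2 * indicator (boundary_layer W r) x \<partial>lborel)"
    proof (rule integral_mono')
      have "emeasure lborel (boundary_layer W r) \<le> emeasure lborel W"
        by (rule emeasure_mono) (auto simp: boundary_layer_def)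
      then have "emeasure lborel (boundary_layer W r) < \<infinity>" using fW by (rule le_less_trans)
      then show "integrable lborel (\<lambda>x. (t * D)\<^sup>2 * indicator (boundary_layer W r) x)"
        using boundary_layer_sets[OF W] by (intro integrable_mult_right) (simp add: integrable_indicator_iff)
      fix x
      show "indicator W x * (G x)\<^sup>2 \<le> (t * D)\<^sup>2 * indicator (boundary_layer W r) x"
      proof (cases "x \<in> boundary_layer W r")
        case True
        have "(G x)\<^sup>2 \<le> (t * D)\<^sup>2" using power_mono[OF G_bound[of x], of 2] by simp
        then show ?thesis using True by (simp add: indicator_def)
      next
        case False
        then show ?thesis
          using G_zero[OF cball_subset_off_boundary_layer[of x W r]] by (simp add: indicator_def)
      qed
    qed simp
    also have "(\<integral>x. (t * D)\<^sup>2 * indicator (boundary_layer W r) x \<partial>lborel) = (t * D)\<^sup>2 * measure lborel (boundary_layer W r)"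
      using boundary_layer_sets[OF W] by simp
    finally show ?thesis
      using t by (simp add: G_def power_mult_distrib power2_eq_square power3_eq_cube mult_ac)
  qed
  have second: "(\<integral>x. (\<integral>y. (f x y)\<^sup>2 \<partial>\<rho>) \<partial>\<rho>) \<le> t\<^sup>2 * measure lborel W * (C / r ^ DIM('a))"
  proof -
    define Q where "Q x = (\<integral>y. (f x y)\<^sup>2 \<partial>\<rho>)" for x
    have "Q x = t * (\<integral>y. indicator W y * (f x y)\<^sup>2 \<partial>lborel)" for x
      unfolding Q_def \<rho>_def by (rule integral_poisson_intensity[OF W t]) measurable
    then have Q_bound: "Q x \<le> t * (C / r ^ DIM('a))" for x
      using f_sq_int[of x] t by (simp only: mult_le_cancel_left_pos)
    have Q_nn: "0 \<le> Q x" for x by (simp add: Q_def)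
    have Q_meas: "Q \<in> borel_measurable borel"
    proof -
      have "Q \<in> borel_measurable \<rho>" unfolding Q_def by measurable
      then show ?thesis by simp
    qed
    have "(\<integral>x. Q x \<partial>\<rho>) = t * (\<integral>x. indicator W x * Q x \<partial>lborel)"
      unfolding \<rho>_def by (rule integral_poisson_intensity[OF W t Q_meas])
    also have "(\<integral>x. indicator W x * Q x \<partial>lborel) \<le> (\<integral>x. t * (C / r ^ DIM('a)) * indicator W x \<partial>lborel)"
    proof (rule integral_mono')
      show "integrable lborel (\<lambda>x. t * (C / r ^ DIM('a)) * indicator W x)"
        using fW by (intro integrable_mult_right) (simp add: integrable_indicator_iff)
      fix x :: 'a
      show "indicator W x * Q x \<le> t * (C / r ^ DIM('a)) * indicator W x"
        using Q_bound[of x] by (simp add: indicator_def)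
      show "0 \<le> t * (C / r ^ DIM('a)) * indicator W x"
        using order_trans[OF Q_nn[of x] Q_bound[of x]] by (intro mult_nonneg_nonneg[of "t * (C / r ^ DIM('a))"]) auto
    qed
    also have "(\<integral>x. t * (C / r ^ DIM('a)) * indicator W x \<partial>lborel) = t * (C / r ^ DIM('a)) * measure lborel W"
      by simp
    finally show ?thesis using t by (simp add: Q_def power2_eq_square mult_ac)
  qed
  \<comment> \<open>Each functional has to be integrable by itself before the expectation of the
    difference can be split.\<close>
  have g_L: "integrable M (\<lambda>\<omega>. length_power \<tau> r (N \<omega>))" if "2 * \<tau> > - real DIM('a)" for \<tau>
  proof -
    have "integrable M (\<lambda>\<omega>. \<Sum>x\<in>distinct_tuples 2 (N \<omega>). g \<tau> (x 0) (x 1))"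
      by (intro pair_sum_variance(1) g_meas g_sym g_diag g_int2 that)
    then show ?thesis
      by (rule Bochner_Integration.integrable_cong[THEN iffD1, rotated -1])
        (simp_all add: length_power_eq_sum_distinct_tuples finite_points g_def)
  qed
  have S_L: "S \<omega> = c1 * length_power \<tau>1 r (N \<omega>) - c2 * length_power \<tau>2 r (N \<omega>)" if "\<omega> \<in> space M" for \<omega>
    using finite_points[OF that]
    by (simp add: S_def length_power_eq_sum_distinct_tuples f_def g_def sum_subtractf sum_distrib_left)
  have ES: "expectation S = c1 * (\<integral>\<omega>. length_power \<tau>1 r (N \<omega>) \<partial>M) - c2 * (\<integral>\<omega>. length_power \<tau>2 r (N \<omega>) \<partial>M)"
  proof -
    have "expectation S = (\<integral>\<omega>. c1 * length_power \<tau>1 r (N \<omega>) - c2 * length_power \<tau>2 r (N \<omega>) \<partial>M)"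
      by (intro Bochner_Integration.integral_cong S_L) auto
    then show ?thesis using g_L \<tau>d by simp
  qed
  have scale: "a * ((u - v) / (p * r powr a)) = (a * r powr (- a) * u - a * r powr (- a) * v) / p" for a u v p
    using r by (cases "p = 0") (simp_all add: powr_minus field_simps)
  \<comment> \<open>Both normalisations share the factor \<open>t powr (3/2)\<close>, so the
    combination is a single centred pair sum.\<close>
  have U: "a1 * normalized_length_power M N t r \<tau>1 \<omega> - a2 * normalized_length_power M N t r \<tau>2 \<omega>
      = (S \<omega> - expectation S) / t powr (3/2)" if "\<omega> \<in> space M" for \<omega>
    unfolding normalized_length_power_eq[OF r t dense] a1_def[symmetric] a2_def[symmetric] scale
      c1_def[symmetric] c2_def[symmetric] S_L[OF that] ES
    by (simp only: diff_divide_distrib[symmetric]) (simp add: algebra_simps)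
  have tp: "t powr (3/2) > 0" using t by simp
  have t3: "(t powr (3/2))\<^sup>2 = t ^ 3"
  proof -
    have "(t powr (3/2))\<^sup>2 = t powr (3/2 + 3/2)" by (simp only: power2_eq_square powr_add)
    also have "\<dots> = t powr real 3" by simp
    finally show ?thesis using t by (simp only: powr_realpow)
  qed
  have S_meas [measurable]: "S \<in> borel_measurable M" using S_int by auto
  have "measure M {\<omega> \<in> space M. \<bar>a1 * normalized_length_power M N t r \<tau>1 \<omega>
      - a2 * normalized_length_power M N t r \<tau>2 \<omega>\<bar> > e}
      = prob {\<omega> \<in> space M. \<bar>S \<omega> - expectation S\<bar> > e * t powr (3/2)}"
    using tp by (intro arg_cong[where f = prob] Collect_cong) (auto simp: U abs_divide field_simps)
  also have "\<dots> \<le> prob {\<omega> \<in> space M. \<bar>S \<omega> - expectation S\<bar> \<ge> e * t powr (3/2)}"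
    by (intro finite_measure_mono) auto
  also have "\<dots> \<le> variance S / (e * t powr (3/2))\<^sup>2"
    using e tp by (intro Chebyshev_inequality S_sq_int) auto
  also have "\<dots> = variance S / t ^ 3 / e\<^sup>2"
    by (simp add: power_mult_distrib t3)
  \<comment> \<open>Division by \<open>t ^ 3\<close> will leave the layer volume without any
    \<open>t\<close> and turn \<open>t\<^sup>2 / r ^ d\<close> into
    \<open>1 / (t * r ^ d)\<close>.\<close>
  also have "\<dots> \<le> (4 * (t ^ 3 * D\<^sup>2 * measure lborel (boundary_layer W r))
      + 2 * (t\<^sup>2 * measure lborel W * (C / r ^ DIM('a)))) / t ^ 3 / e\<^sup>2"
    unfolding S_var using first second t by (intro divide_right_mono add_mono mult_left_mono) auto
  also have "\<dots> = (4 * D\<^sup>2 * measure lborel (boundary_layer W r) +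
      2 * measure lborel W * C / (t * r ^ DIM('a))) / e\<^sup>2"
    using t r by (simp add: add_divide_distrib power2_eq_square power3_eq_cube mult_ac)
  finally show ?thesis .
qed

theorem theorem9p1:
  fixes M :: "'w measure"
    and eta :: "real \<Rightarrow> 'w \<Rightarrow> 'a::euclidean_space set"
    and W :: "'a set"
    and delta :: "real \<Rightarrow> real"
    and tau1 tau2 :: real
  assumes W: "convex W" "compact W"
    and pp: "\<And>t. t > 0 \<Longrightarrow> poisson_pp M (eta t) W t"
    and dpos: "\<And>t. t > 0 \<Longrightarrow> delta t > 0"
    and d0: "(delta \<longlongrightarrow> 0) at_top"
    and dinf: "filterlim (\<lambda>t. t * delta t ^ DIM('a)) at_top at_top"
    and tau1: "tau1 > - real DIM('a) / 2"
    and tau2: "tau2 > - real DIM('a) / 2"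
  shows "\<forall>e>0. ((\<lambda>t. measure M {\<omega>\<in>space M.
            \<bar>(tau1 + real DIM('a)) * normalized_length_power M (eta t) t (delta t) tau1 \<omega>
             - (tau2 + real DIM('a)) * normalized_length_power M (eta t) t (delta t) tau2 \<omega>\<bar> > e})
          \<longlongrightarrow> 0) at_top"
proof (intro allI impI)
  fix e :: real assume e: "e > 0"
  define D where "D = real DIM('a) * unit_ball_vol (real DIM('a))"
  define C where "C = D * ((tau1 + real DIM('a))\<^sup>2 / (2 * tau1 + real DIM('a)) +
    (tau2 + real DIM('a))\<^sup>2 / (2 * tau2 + real DIM('a))) / 2"
  define b where "b t = (4 * D\<^sup>2 * measure lborel (boundary_layer W (delta t)) +
      2 * measure lborel W * C / (t * delta t ^ DIM('a))) / e\<^sup>2" for t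
  \<comment> \<open>\<open>D\<close> and \<open>C\<close> do not depend on \<open>t\<close>, so only
    the layer volume and \<open>1 / (t * delta t ^ d)\<close> vary, and both tend to 0.\<close>
  have "(b \<longlongrightarrow> (4 * D\<^sup>2 * 0 + 0) / e\<^sup>2) at_top"
    unfolding b_def using e
    by (intro tendsto_intros boundary_layer_tendsto_0 W d0
        tendsto_divide_0[OF tendsto_const filterlim_at_top_imp_at_infinity[OF dinf]]) auto
  then have b0: "(b \<longlongrightarrow> 0) at_top" by simp
  have bound: "\<forall>\<^sub>F t in at_top. measure M {\<omega>\<in>space M.
            \<bar>(tau1 + real DIM('a)) * normalized_length_power M (eta t) t (delta t) tau1 \<omega>
             - (tau2 + real DIM('a)) * normalized_length_power M (eta t) t (delta t) tau2 \<omega>\<bar> > e} \<le> b t"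
    using eventually_gt_at_top[of 0] filterlim_at_top[THEN iffD1, OF dinf, rule_format, of 1]
  proof eventually_elim
    case (elim t)
    then show ?case
      unfolding b_def C_def D_def
      by (intro normalized_length_power_deviation W pp dpos tau1 tau2 e)
  qed
  show "((\<lambda>t. measure M {\<omega>\<in>space M.
            \<bar>(tau1 + real DIM('a)) * normalized_length_power M (eta t) t (delta t) tau1 \<omega>
             - (tau2 + real DIM('a)) * normalized_length_power M (eta t) t (delta t) tau2 \<omega>\<bar> > e})
          \<longlongrightarrow> 0) at_top"
    by (rule tendsto_sandwich[OF _ bound tendsto_const b0]) simp
qed

end
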